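(* Let $m,n\in\mathbb{N}$ and let $\Phi: M_n(\mathbb{C})\to M_m(\mathbb{C})$ be a positive linear map such that $\Phi^\dagger(\mathbf{1})\in M_n^{++}(\mathbb{C})$. If $$\operatorname{Tr}\left[\Phi^\dagger(K^* )\,\Phi^\dagger(Y)^{t-1}\,\Phi^\dagger(K)\,\Phi^\dagger(X)^{-t}\right]\le \operatorname{Tr}\left[K^*Y^{t-1}KX^{-t}\right]$$ holds for all $0\le t\le 1$, all $X,Y\in M_m^{++}(\mathbb{C})$ and all $K\in M_m(\mathbb{C})$, then $\Phi$ is a Schwarz map. Thus, satisfaction of this inequality (for all such $t,X,Y,K$) characterizes the class of Schwarz maps among positive linear maps $\Phi$ with $\Phi^\dagger(\mathbf{1})\in M_n^{++}(\mathbb{C})$.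
   Context: $M_m(\mathbb{C})$ denotes the $m\times m$ complex matrices, $M_m^{+}(\mathbb{C})$ the closed cone of positive semidefinite matrices and $M_m^{++}(\mathbb{C})$ the open cone of positive definite matrices in $M_m(\mathbb{C})$; $\mathbf{1}$ is the identity matrix. A linear map $\Phi: M_n(\mathbb{C})\to M_m(\mathbb{C})$ is positive if $\Phi(X)\in M_m^+(\mathbb{C})$ whenever $X\in M_n^+(\mathbb{C})$. Each $M_n(\mathbb{C})$ carries the Hilbert–Schmidt inner product $\langle X,Y\rangle=\operatorname{Tr}[X^*Y]$, and $\Phi^\dagger: M_m(\mathbb{C})\to M_n(\mathbb{C})$ is the adjoint of $\Phi$ with respect to these inner products. A Schwarz map is a linear map $\Phi: M_n(\mathbb{C})\to M_m(\mathbb{C})$ (not necessarily unital) such that $\Phi(K^*K)\ge \Phi(K)^*\Phi(K)$ for all $K\in M_n(\mathbb{C})$. *)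

theory Defs
  imports "HOL-Analysis.Analysis" "HOL-Library.Complex_Order"
begin

text \<open>
  The space of complex \<open>n \<times> n\<close> matrices is the type \<open>complex^'n^'n\<close> with \<open>CARD('n) = n\<close>.
  Matrix products are written \<open>**\<close>; the overloaded \<open>*\<close>, \<open>\<le>\<close> on this type are entrywise and
  are not used.  On complex numbers \<open>\<le>\<close> is the order of \<open>HOL-Library.Complex_Order\<close>:
  \<open>a \<le> b\<close> means that \<open>b - a\<close> is real and nonnegative.
\<close>

subsection \<open>Matrices\<close>

definition mscale :: "complex \<Rightarrow> complex^'n^'m \<Rightarrow> complex^'n^'m" where
  "mscale c A = (\<chi> i j. c * A $ i $ j)"

definition cadjoint :: "complex^'n^'m \<Rightarrow> complex^'m^'n" where
  "cadjoint A = (\<chi> i j. cnj (A $ j $ i))"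

definition quad_form :: "complex^'n^'n \<Rightarrow> complex^'n \<Rightarrow> complex" where
  "quad_form A v = (\<Sum>i\<in>UNIV. cnj (v $ i) * (A *v v) $ i)"

definition hermitian :: "complex^'n^'n \<Rightarrow> bool" where
  "hermitian A \<longleftrightarrow> cadjoint A = A"

definition psd :: "complex^'n^'n \<Rightarrow> bool" where
  "psd A \<longleftrightarrow> hermitian A \<and> (\<forall>v. 0 \<le> quad_form A v)"

definition posdef :: "complex^'n^'n \<Rightarrow> bool" where
  "posdef A \<longleftrightarrow> hermitian A \<and> (\<forall>v. v \<noteq> 0 \<longrightarrow> 0 < quad_form A v)"

definition matrix_le :: "complex^'n^'n \<Rightarrow> complex^'n^'n \<Rightarrow> bool" where
  "matrix_le A B \<longleftrightarrow> psd (B - A)"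

definition unitary :: "complex^'n^'n \<Rightarrow> bool" where
  "unitary U \<longleftrightarrow> cadjoint U ** U = mat 1 \<and> U ** cadjoint U = mat 1"

definition diag_mat :: "('n \<Rightarrow> real) \<Rightarrow> complex^'n^'n" where
  "diag_mat d = (\<chi> i j. if i = j then complex_of_real (d i) else 0)"

text \<open>
  Functional calculus.  The value does not depend on the chosen diagonalization
  (\<open>matrix_fun_eq\<close> below); for a non-Hermitian argument, which has no such diagonalization,
  it is unspecified.
\<close>

definition matrix_fun :: "(real \<Rightarrow> real) \<Rightarrow> complex^'n^'n \<Rightarrow> complex^'n^'n" where
  "matrix_fun f A = (THE B. \<exists>U d. unitary U \<and> A = U ** diag_mat d ** cadjoint U \<and>
                                   B = U ** diag_mat (\<lambda>i. f (d i)) ** cadjoint U)"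

definition matrix_powr :: "complex^'n^'n \<Rightarrow> real \<Rightarrow> complex^'n^'n" where
  "matrix_powr A s = matrix_fun (\<lambda>x. x powr s) A"


subsection \<open>Linear maps between matrix spaces\<close>

abbreviation matrix_linear :: "(complex^'n^'n \<Rightarrow> complex^'m^'m) \<Rightarrow> bool" where
  "matrix_linear \<equiv> Vector_Spaces.linear mscale mscale"

definition positive_map :: "(complex^'n^'n \<Rightarrow> complex^'m^'m) \<Rightarrow> bool" where
  "positive_map \<Phi> \<longleftrightarrow> matrix_linear \<Phi> \<and> (\<forall>X. psd X \<longrightarrow> psd (\<Phi> X))"

definition schwarz_map :: "(complex^'n^'n \<Rightarrow> complex^'m^'m) \<Rightarrow> bool" where
  "schwarz_map \<Phi> \<longleftrightarrow> matrix_linear \<Phi> \<and>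
     (\<forall>K. matrix_le (cadjoint (\<Phi> K) ** \<Phi> K) (\<Phi> (cadjoint K ** K)))"

definition hs_inner :: "complex^'n^'n \<Rightarrow> complex^'n^'n \<Rightarrow> complex" where
  "hs_inner X Y = trace (cadjoint X ** Y)"

text \<open>
  The library constant \<open>adjoint\<close> refers to the real inner product, hence the separate definition.
\<close>

definition hs_adjoint :: "(complex^'n^'n \<Rightarrow> complex^'m^'m) \<Rightarrow> complex^'m^'m \<Rightarrow> complex^'n^'n" where
  "hs_adjoint \<Phi> = (THE \<Psi>. \<forall>X Y. hs_inner (\<Phi> X) Y = hs_inner X (\<Psi> Y))"


subsection \<open>Well-definedness\<close>

lemma vector_space_mscale: "vector_space (mscale :: complex \<Rightarrow> complex^'n^'m \<Rightarrow> _)"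
  by unfold_locales (simp_all add: mscale_def vec_eq_iff algebra_simps)

lemma matrix_linear_iff:
  "matrix_linear \<Phi> \<longleftrightarrow>
     (\<forall>A B. \<Phi> (A + B) = \<Phi> A + \<Phi> B) \<and> (\<forall>c A. \<Phi> (mscale c A) = mscale c (\<Phi> A))"
  by (simp add: Vector_Spaces.linear_iff vector_space_mscale)

lemma hs_inner_entrywise: "hs_inner X Y = (\<Sum>j\<in>UNIV. \<Sum>i\<in>UNIV. cnj (X $ i $ j) * Y $ i $ j)"
  by (simp add: hs_inner_def trace_def cadjoint_def matrix_matrix_mult_def)

lemma sum_delta2:
  fixes g :: "'a::finite \<Rightarrow> 'b::finite \<Rightarrow> complex"
  shows "(\<Sum>j\<in>UNIV. \<Sum>i\<in>UNIV. if i = k \<and> j = l then g i j else 0) = g k l"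
proof -
  have "(\<Sum>i\<in>UNIV. if i = k \<and> j = l then g i j else 0) = (if j = l then g k l else 0)" for j
    by (cases "j = l") simp_all
  then show ?thesis
    by simp
qed

lemma hs_inner_eqI:
  assumes "\<And>X. hs_inner X A = hs_inner X B"
  shows "A = B"
proof -
  have "A $ k $ l = B $ k $ l" for k l
  proof -
    let ?E = "(\<chi> i j. if i = k \<and> j = l then 1 else 0) :: complex^'a^'a"
    have "hs_inner ?E Y = Y $ k $ l" for Y
    proof -
      have "hs_inner ?E Y = (\<Sum>j\<in>UNIV. \<Sum>i\<in>UNIV. if i = k \<and> j = l then Y $ i $ j else 0)"
        unfolding hs_inner_entrywise by (intro sum.cong) simp_all
      then show ?thesis
        by (simp only: sum_delta2)
    qed
    then show ?thesis
      using assms by metis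
  qed
  then show ?thesis
    by (simp add: vec_eq_iff)
qed

lemma hs_adjoint_works:
  assumes "matrix_linear \<Phi>"
  shows "hs_inner (\<Phi> X) Y = hs_inner X (hs_adjoint \<Phi> Y)"
proof -
  let ?E = "\<lambda>k l. (\<chi> i j. if i = k \<and> j = l then 1 else 0) :: complex^'a^'a"
  let ?\<Psi> = "\<lambda>Y. (\<chi> k l. hs_inner (\<Phi> (?E k l)) Y)"
  interpret lin: Vector_Spaces.linear mscale mscale \<Phi>
    by (rule assms)
  have hs_add: "hs_inner (\<Sum>a\<in>S. f a) Y = (\<Sum>a\<in>S. hs_inner (f a) Y)"
    for S :: "'a set" and f :: "'a \<Rightarrow> complex^'b^'b" and Y
  proof -
    have "hs_inner 0 Y = 0" "hs_inner (A + B) Y = hs_inner A Y + hs_inner B Y" for A B :: "complex^'b^'b"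
      by (simp_all add: hs_inner_entrywise algebra_simps sum.distrib)
    then show ?thesis
      by (induction S rule: infinite_finite_induct) simp_all
  qed
  have hs_scale: "hs_inner (mscale c A) Y = cnj c * hs_inner A Y" for c and A Y :: "complex^'b^'b"
    by (simp add: hs_inner_entrywise mscale_def sum_distrib_left algebra_simps)
  have ex: "hs_inner (\<Phi> X) Y = hs_inner X (?\<Psi> Y)" for X Y
  proof -
    have "X = (\<Sum>l\<in>UNIV. \<Sum>k\<in>UNIV. mscale (X $ k $ l) (?E k l))"
    proof -
      have "(\<Sum>l\<in>UNIV. \<Sum>k\<in>UNIV. mscale (X $ k $ l) (?E k l)) $ i $ j = X $ i $ j" for i j
      proof -
        have "(\<Sum>l\<in>UNIV. \<Sum>k\<in>UNIV. mscale (X $ k $ l) (?E k l)) $ i $ j =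
            (\<Sum>l\<in>UNIV. \<Sum>k\<in>UNIV. if k = i \<and> l = j then X $ k $ l else 0)"
          unfolding sum_component by (intro sum.cong) (auto simp: mscale_def)
        then show ?thesis
          by (simp only: sum_delta2)
      qed
      then show ?thesis
        by (simp add: vec_eq_iff)
    qed
    then have "\<Phi> X = (\<Sum>l\<in>UNIV. \<Sum>k\<in>UNIV. mscale (X $ k $ l) (\<Phi> (?E k l)))"
      by (metis (no_types, lifting) lin.sum lin.scale sum.cong)
    then have "hs_inner (\<Phi> X) Y =
        (\<Sum>l\<in>UNIV. \<Sum>k\<in>UNIV. cnj (X $ k $ l) * hs_inner (\<Phi> (?E k l)) Y)"
      by (simp add: hs_add hs_scale)
    then show ?thesis
      by (simp add: hs_inner_entrywise)
  qed
  have "\<forall>X Y. hs_inner (\<Phi> X) Y = hs_inner X (hs_adjoint \<Phi> Y)"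
    unfolding hs_adjoint_def
  proof (rule theI[of _ ?\<Psi>])
    show "\<forall>X Y. hs_inner (\<Phi> X) Y = hs_inner X (?\<Psi> Y)"
      using ex by blast
    fix \<Psi>' assume "\<forall>X Y. hs_inner (\<Phi> X) Y = hs_inner X (\<Psi>' Y)"
    then show "\<Psi>' = ?\<Psi>"
      using ex by (intro ext hs_inner_eqI) metis
  qed
  then show ?thesis
    by blast
qed

lemma diag_intertwine:
  assumes "W ** diag_mat d = diag_mat e ** W"
  shows "W ** diag_mat (\<lambda>i. f (d i)) = diag_mat (\<lambda>i. f (e i)) ** W"
proof -
  have right: "(W ** diag_mat d) $ i $ j = W $ i $ j * complex_of_real (d j)" for W d i j
    by (simp add: matrix_matrix_mult_def diag_mat_def if_distrib cong: if_cong)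
  have left: "(diag_mat e ** W) $ i $ j = complex_of_real (e i) * W $ i $ j" for W e i j
  proof -
    have "(diag_mat e ** W) $ i $ j =
        (\<Sum>k\<in>UNIV. if k = i then complex_of_real (e i) * W $ k $ j else 0)"
      unfolding matrix_matrix_mult_def diag_mat_def vec_lambda_beta by (intro sum.cong) auto
    then show ?thesis
      by simp
  qed
  have "W $ i $ j = 0 \<or> d j = e i" for i j
  proof -
    have "W $ i $ j * complex_of_real (d j) = complex_of_real (e i) * W $ i $ j"
      using assms by (metis left right)
    then show ?thesis
      by (metis mult.commute mult_cancel_right of_real_eq_iff)
  qed
  then have "W $ i $ j * complex_of_real (f (d j)) = complex_of_real (f (e i)) * W $ i $ j" for i j
    by (metis mult.commute mult_zero_right)
  then show ?thesis
    unfolding vec_eq_iff left right by blast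
qed

lemma matrix_fun_eq:
  assumes "unitary U" "A = U ** diag_mat d ** cadjoint U"
  shows "matrix_fun f A = U ** diag_mat (\<lambda>i. f (d i)) ** cadjoint U"
  unfolding matrix_fun_def
proof (rule the_equality)
  show "\<exists>V e. unitary V \<and> A = V ** diag_mat e ** cadjoint V \<and>
      U ** diag_mat (\<lambda>i. f (d i)) ** cadjoint U = V ** diag_mat (\<lambda>i. f (e i)) ** cadjoint V"
    using assms by blast
  fix B
  assume "\<exists>V e. unitary V \<and> A = V ** diag_mat e ** cadjoint V \<and>
      B = V ** diag_mat (\<lambda>i. f (e i)) ** cadjoint V"
  then obtain V e where V: "unitary V" "A = V ** diag_mat e ** cadjoint V"
    and B: "B = V ** diag_mat (\<lambda>i. f (e i)) ** cadjoint V"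
    by blast
  let ?W = "cadjoint V ** U"
  have U1: "cadjoint U ** U = mat 1" and U2: "U ** cadjoint U = mat 1"
    and V1: "cadjoint V ** V = mat 1" and V2: "V ** cadjoint V = mat 1"
    using assms(1) V(1) by (simp_all add: unitary_def)
  have "?W ** diag_mat d = cadjoint V ** (U ** diag_mat d ** cadjoint U) ** U"
    by (metis U1 matrix_mul_assoc matrix_mul_rid)
  also have "\<dots> = cadjoint V ** (V ** diag_mat e ** cadjoint V) ** U"
    using assms(2) V(2) by simp
  also have "\<dots> = diag_mat e ** ?W"
    by (metis V1 matrix_mul_assoc matrix_mul_lid)
  finally have *: "?W ** diag_mat (\<lambda>i. f (d i)) = diag_mat (\<lambda>i. f (e i)) ** ?W"
    by (rule diag_intertwine)
  have "B = V ** (diag_mat (\<lambda>i. f (e i)) ** ?W) ** cadjoint U"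
    unfolding B by (metis U2 matrix_mul_assoc matrix_mul_rid)
  also have "\<dots> = V ** (?W ** diag_mat (\<lambda>i. f (d i))) ** cadjoint U"
    using * by simp
  also have "\<dots> = U ** diag_mat (\<lambda>i. f (d i)) ** cadjoint U"
    by (metis V2 matrix_mul_assoc matrix_mul_lid)
  finally show "B = U ** diag_mat (\<lambda>i. f (d i)) ** cadjoint U" .
qed

end

theory Submission
  imports Defs "HOL-Complex_Analysis.Conformal_Mappings"
begin

text \<open>
  Write \<open>\<Psi>\<close> for the adjoint of \<open>\<Phi>\<close>.  At \<open>t = 1\<close> the trace inequality reads
  \<open>Tr (\<Psi> K (\<Psi> X)\<^sup>-\<^sup>1 (\<Psi> K)\<^sup>*) \<le> Tr (K X\<^sup>-\<^sup>1 K\<^sup>*)\<close>, and at \<open>t = 0\<close> it is the same inequality for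
  \<open>K\<^sup>*\<close> and \<open>Y\<close>.  This endpoint inequality is dual to the Schwarz inequality.  Completing the square,
  \<open>Tr (P Z\<^sup>-\<^sup>1 P\<^sup>*)\<close> is the maximum over \<open>A\<close> of \<open>2 Re Tr (P A\<^sup>*) - Tr (A Z A\<^sup>*)\<close>
  (\<open>completing_square\<close>).  For \<open>P = \<Psi> K\<close> and \<open>Z = \<Psi> X\<close> the function to be maximized is
  \<open>2 Re Tr (K (\<Phi> A)\<^sup>*) - Tr (\<Phi> (A\<^sup>* A) X)\<close>, whereas for \<open>P = K\<close> and \<open>Z = X\<close>, at the point
  \<open>\<Phi> A\<close>, it is \<open>2 Re Tr (K (\<Phi> A)\<^sup>*) - Tr ((\<Phi> A)\<^sup>* \<Phi> A X)\<close>.  Comparing the two gives both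
  directions, \<open>schwarz_map_imp_dual\<close> and \<open>schwarz_map_if_dual\<close>.  In particular the trace inequality
  at \<open>t = 1\<close> alone forces \<open>\<Phi>\<close> to be a Schwarz map.

  Conversely, a Schwarz map satisfies the inequality at both endpoints, and the values
  \<open>0 < t < 1\<close> follow by interpolation.  Left multiplication by \<open>Y\<^sup>-\<^sup>1\<close> and right multiplication
  by \<open>X\<^sup>-\<^sup>1\<close> commute, and in their common eigenbasis \<open>Tr (K\<^sup>* Y\<^sup>t\<^sup>-\<^sup>1 K X\<^sup>-\<^sup>t)\<close> is a weighted sum of
  squares of the coordinates of \<open>K\<close> whose weight is a geometric mean of the weights at the endpoints
  (\<open>lieb_trace_diagonal\<close>).  So \<open>\<Psi>\<close> is a contraction between weighted \<open>\<ell>\<^sup>2\<close> spaces at \<open>t = 0\<close>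
  and at \<open>t = 1\<close>, hence for every \<open>t\<close> between them (\<open>weighted_l2_interpolation\<close>), by the three
  lines theorem.  The eigenbases come from the spectral theorem, \<open>hermitian_diagonalization\<close>.
\<close>

section \<open>Conjugate transposes, traces and quadratic forms\<close>

lemma cadjoint_cadjoint [simp]: "cadjoint (cadjoint A) = A"
  by (simp add: cadjoint_def vec_eq_iff)

lemma cadjoint_add: "cadjoint (A + B) = cadjoint A + cadjoint B"
  by (simp add: cadjoint_def vec_eq_iff)

lemma cadjoint_diff: "cadjoint (A - B) = cadjoint A - cadjoint B"
  by (simp add: cadjoint_def vec_eq_iff)

lemma cadjoint_mult: "cadjoint (A ** B) = cadjoint B ** cadjoint A"
  by (simp add: cadjoint_def vec_eq_iff matrix_matrix_mult_def mult.commute)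

lemma cadjoint_mscale: "cadjoint (mscale c A) = mscale (cnj c) (cadjoint A)"
  by (simp add: cadjoint_def mscale_def vec_eq_iff)

lemma cadjoint_mat_1 [simp]: "cadjoint (mat 1) = mat 1"
  by (auto simp: cadjoint_def mat_def vec_eq_iff)

lemma cadjoint_diag_mat [simp]: "cadjoint (diag_mat d) = diag_mat d"
  by (auto simp: cadjoint_def diag_mat_def vec_eq_iff)

lemma matrix_diff_ldistrib: "A ** (B - C) = A ** B - A ** C" for A :: "complex^'n^'m"
  by (simp add: matrix_matrix_mult_def vec_eq_iff sum_subtractf algebra_simps)

lemma matrix_diff_rdistrib: "(A - B) ** C = A ** C - B ** C" for A :: "complex^'n^'m"
  by (simp add: matrix_matrix_mult_def vec_eq_iff sum_subtractf algebra_simps)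

lemma matrix_add_rdistrib: "(A + B) ** C = A ** C + B ** C" for A :: "complex^'n^'m"
  by (simp add: matrix_matrix_mult_def vec_eq_iff sum.distrib algebra_simps)

lemma mscale_mult_left: "mscale c A ** B = mscale c (A ** B)"
  by (simp add: mscale_def matrix_matrix_mult_def vec_eq_iff sum_distrib_left mult.assoc)

lemma mscale_mult_right: "A ** mscale c B = mscale c (A ** B)"
  by (simp add: mscale_def matrix_matrix_mult_def vec_eq_iff sum_distrib_left mult.left_commute)

lemma mscale_1 [simp]: "mscale 1 A = A"
  by (simp add: mscale_def vec_eq_iff)

lemma mscale_mscale: "mscale c (mscale d A) = mscale (c * d) A"
  by (simp add: mscale_def vec_eq_iff mult.assoc)

lemma trace_cadjoint: "trace (cadjoint A) = cnj (trace A)"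
  by (simp add: trace_def cadjoint_def)

lemma trace_mscale: "trace (mscale c A) = c * trace A"
  by (simp add: trace_def mscale_def sum_distrib_left)

text \<open>
  The Hermitian form of \<open>\<complex>\<^sup>n\<close>, antilinear in the first argument.  The library's
  \<open>\<bullet>\<close> on this type is its real part, which is enough for variational arguments but does not
  detect complex orthogonality.
\<close>

definition cinner :: "complex^'n \<Rightarrow> complex^'n \<Rightarrow> complex" where
  "cinner v w = (\<Sum>i\<in>UNIV. cnj (v $ i) * w $ i)"

lemma cinner_add_right: "cinner v (x + y) = cinner v x + cinner v y"
  and cinner_diff_right: "cinner v (x - y) = cinner v x - cinner v y"
  and cinner_scaleR_right: "cinner v (r *\<^sub>R x) = of_real r * cinner v x"
  and cinner_scale_right: "cinner v (c *s x) = c * cinner v x"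
  and cinner_zero_right [simp]: "cinner v 0 = 0"
  by (simp_all add: cinner_def algebra_simps sum.distrib sum_subtractf sum_distrib_left
      scaleR_conv_of_real[where 'a = complex])

lemma cinner_scaleR_left: "cinner (r *\<^sub>R v) w = of_real r * cinner v w"
  by (simp add: cinner_def algebra_simps sum_distrib_left scaleR_conv_of_real[where 'a = complex])

lemma cinner_sum_right: "cinner v (\<Sum>s\<in>S. f s) = (\<Sum>s\<in>S. cinner v (f s))"
  by (induction S rule: infinite_finite_induct) (simp_all add: cinner_add_right)

lemma cinner_commute: "cinner w v = cnj (cinner v w)"
  by (simp add: cinner_def mult.commute)

lemma inner_eq_Re_cinner: "v \<bullet> w = Re (cinner v w)"
  by (simp add: inner_vec_def cinner_def inner_complex_def)

lemma cinner_self: "cinner v v = of_real ((norm v)\<^sup>2)"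
  by (simp add: cinner_def norm_vec_def L2_set_def sum_nonneg mult.commute complex_norm_square[symmetric])

lemma cinner_cadjoint: "cinner v (A *v w) = cinner (cadjoint A *v v) w"
proof -
  have "cinner v (A *v w) = (\<Sum>i\<in>UNIV. \<Sum>j\<in>UNIV. cnj (v $ i) * A $ i $ j * w $ j)"
    by (simp add: cinner_def matrix_vector_mult_def sum_distrib_left mult.assoc)
  also have "\<dots> = (\<Sum>j\<in>UNIV. \<Sum>i\<in>UNIV. cnj (v $ i) * A $ i $ j * w $ j)"
    by (rule sum.swap)
  also have "\<dots> = cinner (cadjoint A *v v) w"
    by (simp add: cinner_def matrix_vector_mult_def cadjoint_def sum_distrib_left sum_distrib_right
        mult_ac)
  finally show ?thesis .
qed

lemma quad_form_cinner: "quad_form A v = cinner v (A *v v)"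
  by (simp add: quad_form_def cinner_def)

lemma quad_form_congruence: "quad_form (cadjoint B ** A ** B) v = quad_form A (B *v v)"
  by (simp add: quad_form_cinner cinner_cadjoint[of v "cadjoint B"]
      flip: matrix_vector_mul_assoc)

lemma quad_form_mat_1: "quad_form (mat 1) v = of_real ((norm v)\<^sup>2)"
  by (simp add: quad_form_cinner cinner_self)

lemma quad_form_add: "quad_form (A + B) v = quad_form A v + quad_form B v"
  by (simp add: quad_form_cinner matrix_vector_mult_add_rdistrib cinner_add_right)

lemma quad_form_diag_mat: "quad_form (diag_mat d) v = of_real (\<Sum>i\<in>UNIV. d i * (cmod (v $ i))\<^sup>2)"
proof -
  have "(diag_mat d *v v) $ i = of_real (d i) * v $ i" for i
  proof -
    have "(diag_mat d *v v) $ i = (\<Sum>j\<in>UNIV. if j = i then of_real (d i) * v $ i else 0)"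
      unfolding matrix_vector_mult_def diag_mat_def vec_lambda_beta by (intro sum.cong) auto
    then show ?thesis by simp
  qed
  then show ?thesis
    by (auto simp: quad_form_def complex_norm_square simp del: of_real_power intro!: sum.cong)
qed

lemma quad_form_axis: "quad_form A (axis i 1) = A $ i $ i"
proof -
  have "quad_form A (axis i 1) = (\<Sum>k\<in>UNIV. if k = i then A $ i $ i else 0)"
    unfolding quad_form_def
    by (intro sum.cong) (auto simp: axis_def matrix_vector_mult_def if_distrib cong: if_cong)
  then show ?thesis by simp
qed

lemma trace_quad_form: "trace A = (\<Sum>i\<in>UNIV. quad_form A (axis i 1))"
  by (simp add: trace_def quad_form_axis)

lemma matrix_vector_mult_scaleR_right: "A *v (r *\<^sub>R w) = r *\<^sub>R (A *v w)" for A :: "complex^'n^'m"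
  by (rule linear_scale) (rule matrix_vector_mul_linear)

section \<open>Diagonalization of Hermitian matrices\<close>

lemma hermitian_inner_commute:
  assumes "hermitian A"
  shows "v \<bullet> (A *v w) = (A *v v) \<bullet> w"
  using assms by (simp add: inner_eq_Re_cinner cinner_cadjoint[of v A] hermitian_def)

text \<open>
  A maximizer of the quadratic form on the unit sphere of the subspace is an eigenvector.  The
  subspace is a real one; an invariant real subspace suffices because the variation is along the
  single direction \<open>u = A v - \<mu> v\<close>.
\<close>

lemma hermitian_eigenvector_in_subspace:
  fixes A :: "complex^'n^'n"
  assumes A: "hermitian A" and W: "subspace W" "W \<noteq> {0}"
    and inv: "\<And>v. v \<in> W \<Longrightarrow> A *v v \<in> W"
  shows "\<exists>v\<in>W. norm v = 1 \<and> (\<exists>\<mu>::real. A *v v = \<mu> *\<^sub>R v)"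
proof -
  let ?S = "W \<inter> sphere 0 1"
  have "compact ?S"
    by (intro closed_Int_compact closed_subspace W compact_sphere)
  moreover have "?S \<noteq> {}"
  proof -
    obtain w where "w \<in> W" "w \<noteq> 0"
      using W subspace_0 by blast
    then have "w /\<^sub>R norm w \<in> ?S"
      using W(1) by (simp add: subspace_scale)
    then show ?thesis by blast
  qed
  moreover have "continuous_on ?S (\<lambda>v. v \<bullet> (A *v v))"
    by (intro continuous_intros linear_continuous_on matrix_vector_mul_bounded_linear)
  ultimately obtain v where v: "v \<in> ?S" and max: "\<And>w. w \<in> ?S \<Longrightarrow> w \<bullet> (A *v w) \<le> v \<bullet> (A *v v)"
    by (metis (no_types, lifting) continuous_attains_sup)
  define \<mu> where "\<mu> = v \<bullet> (A *v v)"
  define g where "g = (\<lambda>w. \<mu> * (w \<bullet> w) - w \<bullet> (A *v w))"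
  have vv: "v \<bullet> v = 1" "norm v = 1" and vW: "v \<in> W"
    using v by (auto simp: dot_square_norm)
  have g_nonneg: "0 \<le> g w" if "w \<in> W" for w
  proof (cases "w = 0")
    case False
    then have "w /\<^sub>R norm w \<in> ?S"
      using that W(1) by (simp add: subspace_scale)
    from max[OF this] have "(w \<bullet> (A *v w)) / (norm w)\<^sup>2 \<le> \<mu>"
      by (simp add: \<mu>_def matrix_vector_mult_scaleR_right divide_inverse power2_eq_square mult_ac)
    then show ?thesis
      using False by (simp add: g_def divide_le_eq dot_square_norm)
  qed (simp add: g_def)
  define u where "u = A *v v - \<mu> *\<^sub>R v"
  have uW: "u \<in> W"
    unfolding u_def by (intro subspace_diff subspace_scale W inv vW)
  have Av: "A *v v = u + \<mu> *\<^sub>R v"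
    by (simp add: u_def)
  have uv: "u \<bullet> v = 0"
    using vv by (simp add: u_def inner_diff_left inner_commute[of "A *v v" v] \<mu>_def)
  have quad: "g (v + s *\<^sub>R u) = s\<^sup>2 * g u - 2 * s * (u \<bullet> u)" for s
    using hermitian_inner_commute[OF A, of v u]
    by (simp add: g_def matrix_vector_right_distrib matrix_vector_mult_scaleR_right inner_add_left
        inner_add_right Av uv vv inner_commute[of v u] power2_eq_square algebra_simps)
  \<comment> \<open>A nonnegative quadratic polynomial without constant term has no linear term.\<close>
  have "u \<bullet> u = 0"
  proof (rule ccontr)
    assume "u \<bullet> u \<noteq> 0"
    then have pos: "0 < u \<bullet> u" by simp
    have nonneg: "0 \<le> s\<^sup>2 * g u - 2 * s * (u \<bullet> u)" for s
      using g_nonneg[of "v + s *\<^sub>R u"] quad[of s] W(1) vW uW by (simp add: subspace_add subspace_scale)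
    show False
    proof (cases "g u = 0")
      case True
      then show False using nonneg[of 1] pos by simp
    next
      case False
      then have "0 < g u" using g_nonneg[OF uW] by simp
      then show False
        using nonneg[of "u \<bullet> u / g u"] pos mult_pos_pos[OF pos pos] by (simp add: field_simps power2_eq_square)
    qed
  qed
  then show ?thesis
    using vv vW Av by auto
qed

text \<open>
  Take an orthonormal set of eigenvectors of maximal cardinality.  Its orthogonal complement is
  invariant, so a nonzero complement would contain one more eigenvector; hence the set spans the
  space.  That it has exactly \<open>n\<close> elements follows by summing Parseval's identity over the standard
  basis, and the eigenvectors are then the columns of the unitary matrix.
\<close>

lemma hermitian_diagonalization:
  fixes A :: "complex^'n^'n"
  assumes A: "hermitian A"
  obtains U d where "unitary U" "A = U ** diag_mat d ** cadjoint U"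
proof -
  define P where "P = (\<lambda>S. finite S \<and> (\<forall>v\<in>S. norm v = 1 \<and> (\<exists>\<mu>::real. A *v v = \<mu> *\<^sub>R v)) \<and>
    (\<forall>v\<in>S. \<forall>w\<in>S. v \<noteq> w \<longrightarrow> cinner v w = 0))"
  have bound: "card S \<le> DIM(complex^'n)" if "P S" for S
  proof -
    have "independent S"
      using that by (intro pairwise_orthogonal_independent)
        (auto simp: P_def pairwise_def orthogonal_def inner_eq_Re_cinner)
    then show ?thesis using independent_bound by blast
  qed
  have "P {}" by (simp add: P_def)
  then obtain S where S: "P S" and max: "\<And>T. P T \<Longrightarrow> card T \<le> card S"
    using ex_has_greatest_nat[of P "{}" card "Suc DIM(complex^'n)"] bound
    by (meson le_imp_less_Suc)
  have fin: "finite S" and unit: "\<And>v. v \<in> S \<Longrightarrow> cinner v v = 1"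
    and eig: "\<And>v. v \<in> S \<Longrightarrow> \<exists>\<mu>::real. A *v v = \<mu> *\<^sub>R v"
    and orth: "\<And>v w. v \<in> S \<Longrightarrow> w \<in> S \<Longrightarrow> v \<noteq> w \<Longrightarrow> cinner v w = 0"
    using S by (auto simp: P_def cinner_self)
  define W where "W = {w. \<forall>s\<in>S. cinner s w = 0}"
  have "W = {0}"
  proof (rule ccontr)
    assume "W \<noteq> {0}"
    moreover have "subspace W"
      by (auto simp: W_def subspace_def cinner_add_right cinner_scaleR_right)
    moreover have "A *v w \<in> W" if "w \<in> W" for w
    proof -
      have "cinner s (A *v w) = 0" if "s \<in> S" for s
      proof -
        from eig[OF that] obtain \<mu> :: real where "A *v s = \<mu> *\<^sub>R s" by blast
        then show ?thesis
          using A \<open>w \<in> W\<close> that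
          by (simp add: cinner_cadjoint[of s A] hermitian_def cinner_scaleR_left W_def)
      qed
      then show ?thesis by (simp add: W_def)
    qed
    ultimately obtain v where v: "v \<in> W" "norm v = 1" "\<exists>\<mu>::real. A *v v = \<mu> *\<^sub>R v"
      using hermitian_eigenvector_in_subspace[OF A] by blast
    have "v \<notin> S"
      using v(1) unit unfolding W_def by force
    have "cinner s v = 0" "cinner v s = 0" if "s \<in> S" for s
      using v(1) that cinner_commute[of v s] by (auto simp: W_def)
    then have "P (insert v S)"
      using S v(2,3) by (simp add: P_def)
    then show False
      using max[of "insert v S"] fin \<open>v \<notin> S\<close> by simp
  qed
  have expand: "w = (\<Sum>s\<in>S. cinner s w *s s)" for w
  proof -
    have "cinner r (\<Sum>s\<in>S. cinner s w *s s) = cinner r w" if "r \<in> S" for r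
    proof -
      have "cinner r (\<Sum>s\<in>S. cinner s w *s s) = (\<Sum>s\<in>S. if s = r then cinner r w else 0)"
        unfolding cinner_sum_right cinner_scale_right
        using that by (intro sum.cong) (auto simp: unit orth)
      then show ?thesis using fin that by simp
    qed
    then have "w - (\<Sum>s\<in>S. cinner s w *s s) \<in> W"
      by (simp add: W_def cinner_diff_right)
    then show ?thesis using \<open>W = {0}\<close> by simp
  qed
  have "(\<Sum>s\<in>S. (cmod (s $ i))\<^sup>2) = 1" for i
  proof -
    have "cinner s (axis i 1) = cnj (s $ i)" for s
    proof -
      have "cinner s (axis i 1) = (\<Sum>k\<in>UNIV. if k = i then cnj (s $ i) else 0)"
        unfolding cinner_def by (intro sum.cong) (auto simp: axis_def)
      then show ?thesis by simp
    qed
    then have "(axis i 1 :: complex^'n) $ i = (\<Sum>s\<in>S. cnj (s $ i) * s $ i)"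
      by (subst expand) simp
    then have "complex_of_real (\<Sum>s\<in>S. (cmod (s $ i))\<^sup>2) = 1"
      by (simp add: complex_norm_square mult.commute del: of_real_power)
    then show ?thesis using of_real_eq_1_iff by blast
  qed
  then have "real CARD('n) = (\<Sum>i\<in>UNIV. \<Sum>s\<in>S. (cmod (s $ (i::'n)))\<^sup>2)"
    by simp
  also have "\<dots> = (\<Sum>s\<in>S. \<Sum>i\<in>UNIV. (cmod (s $ i))\<^sup>2)"
    by (rule sum.swap)
  also have "\<dots> = (\<Sum>s\<in>S. (norm s)\<^sup>2)"
    by (simp add: norm_vec_def L2_set_def sum_nonneg)
  also have "\<dots> = card S"
    using S by (simp add: P_def)
  finally have "card (UNIV :: 'n set) = card S" by simp
  then obtain h where h: "bij_betw h (UNIV :: 'n set) S"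
    using fin finite_same_card_bij[of "UNIV :: 'n set" S] by auto
  have hS: "h j \<in> S" for j
    using h by (auto simp: bij_betw_def)
  have hinj: "h i = h j \<longleftrightarrow> i = j" for i j
    using h by (auto simp: bij_betw_def inj_on_def)
  obtain d :: "'n \<Rightarrow> real" where d: "\<And>j. A *v h j = d j *\<^sub>R h j"
    using eig[OF hS] by metis
  define U :: "complex^'n^'n" where "U = (\<chi> i j. h j $ i)"
  have "(cadjoint U ** U) $ i $ j = cinner (h i) (h j)" for i j
    by (simp add: matrix_matrix_mult_def cadjoint_def U_def cinner_def)
  then have U1: "cadjoint U ** U = mat 1"
    unfolding vec_eq_iff mat_def vec_lambda_beta using unit[OF hS] orth[OF hS hS] hinj by auto
  then have U2: "U ** cadjoint U = mat 1"
    by (simp add: matrix_left_right_inverse)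
  have "A ** U = U ** diag_mat d"
  proof -
    have "(A ** U) $ i $ j = (A *v h j) $ i" for i j
      by (simp add: matrix_matrix_mult_def matrix_vector_mult_def U_def)
    moreover have "(U ** diag_mat d) $ i $ j = (d j *\<^sub>R h j) $ i" for i j
      by (simp add: matrix_matrix_mult_def diag_mat_def U_def if_distrib scaleR_conv_of_real[where 'a = complex]
          mult.commute cong: if_cong)
    ultimately show ?thesis by (simp add: vec_eq_iff d)
  qed
  then have "A = U ** diag_mat d ** cadjoint U"
    by (metis U2 matrix_mul_assoc matrix_mul_rid)
  with U1 U2 show ?thesis
    using that by (auto simp: unitary_def)
qed

section \<open>The three lines theorem and interpolation of weights\<close>

text \<open>
  Hadamard's three lines theorem, for equal bounds on both edges.  Multiplication by
  \<open>exp (e * (z\<^sup>2 - 1))\<close> does not increase the modulus on the strip and makes the function decay along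
  it, so that the maximum modulus principle on tall rectangles applies; then \<open>e\<close> tends to 0.
\<close>

lemma three_lines:
  fixes f :: "complex \<Rightarrow> complex"
  assumes holo: "f holomorphic_on {z. 0 < Re z \<and> Re z < 1}"
    and cont: "continuous_on {z. 0 \<le> Re z \<and> Re z \<le> 1} f"
    and bounded: "\<And>z. 0 \<le> Re z \<Longrightarrow> Re z \<le> 1 \<Longrightarrow> cmod (f z) \<le> M"
    and left: "\<And>z. Re z = 0 \<Longrightarrow> cmod (f z) \<le> B"
    and right: "\<And>z. Re z = 1 \<Longrightarrow> cmod (f z) \<le> B"
    and z: "0 \<le> Re z" "Re z \<le> 1"
  shows "cmod (f z) \<le> B"
proof -
  have B: "0 \<le> B" using left[of 0] norm_ge_zero[of "f 0"] by (simp del: norm_ge_zero)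
  have M: "0 \<le> M" using bounded[of 0] norm_ge_zero[of "f 0"] by (simp del: norm_ge_zero)
  have damped: "cmod (f z * exp (of_real e * (z\<^sup>2 - 1))) \<le> B" if "0 < e" for e :: real
  proof -
    let ?g = "\<lambda>z. f z * exp (of_real e * (z\<^sup>2 - 1))"
    have weight: "cmod (exp (of_real e * (w\<^sup>2 - 1))) \<le> exp (- e * (Im w)\<^sup>2)"
      if "0 \<le> Re w" "Re w \<le> 1" for w
    proof -
      have "(Re w)\<^sup>2 \<le> 1" using that by (simp add: power_le_one)
      then have "e * ((Re w)\<^sup>2 - (Im w)\<^sup>2 - 1) \<le> e * (- (Im w)\<^sup>2)"
        using \<open>0 < e\<close> by (intro mult_left_mono) auto
      then show ?thesis by (simp add: Re_power2)
    qed
    have box: "cmod (?g z) \<le> B + M * exp (- e * R\<^sup>2)" if R: "\<bar>Im z\<bar> \<le> R" for R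
    proof (rule maximum_modulus_frontier[of ?g "cbox (Complex 0 (- R)) (Complex 1 R)"])
      let ?Q = "cbox (Complex 0 (- R)) (Complex 1 R)"
      show "?g holomorphic_on interior ?Q"
        by (intro holomorphic_intros holomorphic_on_subset[OF holo])
          (auto simp: in_box_complex_iff)
      show "continuous_on (closure ?Q) ?g"
        by (intro continuous_intros continuous_on_subset[OF cont])
          (auto simp: in_cbox_complex_iff)
      show "bounded ?Q" by simp
      show "z \<in> ?Q" using z R by (auto simp: in_cbox_complex_iff)
      fix w assume w: "w \<in> frontier ?Q"
      then have wQ: "0 \<le> Re w" "Re w \<le> 1"
        and edge: "Re w = 0 \<or> Re w = 1 \<or> Im w = - R \<or> Im w = R"
        by (auto simp: frontier_cbox in_cbox_complex_iff in_box_complex_iff)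
      have small: "cmod (exp (of_real e * (w\<^sup>2 - 1))) \<le> 1"
        using weight[OF wQ] \<open>0 < e\<close> by (smt (verit) exp_le_one_iff mult_nonneg_nonneg
          mult_minus_left zero_le_power2)
      have "cmod (f w) * cmod (exp (of_real e * (w\<^sup>2 - 1))) \<le> B + M * exp (- e * R\<^sup>2)"
      proof (cases "Re w = 0 \<or> Re w = 1")
        case True
        then have "cmod (f w) \<le> B" using left right by blast
        then have "cmod (f w) * cmod (exp (of_real e * (w\<^sup>2 - 1))) \<le> B * 1"
          using small B by (intro mult_mono) auto
        then show ?thesis using M by (simp add: add_increasing2)
      next
        case False
        then have "(Im w)\<^sup>2 = R\<^sup>2" using edge by auto
        then have "cmod (f w) * cmod (exp (of_real e * (w\<^sup>2 - 1))) \<le> M * exp (- e * R\<^sup>2)"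
          using weight[OF wQ] bounded[OF wQ] M by (intro mult_mono) auto
        then show ?thesis using B by simp
      qed
      then show "cmod (?g w) \<le> B + M * exp (- e * R\<^sup>2)" by (simp only: norm_mult)
    qed
    have lim: "((\<lambda>R. B + M * exp (- e * R\<^sup>2)) \<longlongrightarrow> B + M * 0) at_top"
    proof (intro tendsto_intros)
      have "filterlim (\<lambda>R. e * R\<^sup>2) at_top at_top"
        using \<open>0 < e\<close> by (intro filterlim_tendsto_pos_mult_at_top[OF tendsto_const] filterlim_pow_at_top
            filterlim_ident) auto
      then have "filterlim (\<lambda>R. - e * R\<^sup>2) at_bot at_top"
        by (simp add: filterlim_uminus_at_top)
      then show "((\<lambda>R. exp (- e * R\<^sup>2)) \<longlongrightarrow> 0) at_top"
        by (rule filterlim_compose[OF exp_at_bot])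
    qed
    have "\<forall>\<^sub>F R in at_top. cmod (?g z) \<le> B + M * exp (- e * R\<^sup>2)"
      using eventually_ge_at_top[of "\<bar>Im z\<bar>"] by eventually_elim (rule box)
    from tendsto_lowerbound[OF lim this] show ?thesis
      by simp
  qed
  have lim: "((\<lambda>e. cmod (f z * exp (of_real e * (z\<^sup>2 - 1)))) \<longlongrightarrow> cmod (f z * exp (of_real 0 * (z\<^sup>2 - 1)))) (at_right 0)"
    by (intro tendsto_intros)
  have "\<forall>\<^sub>F e in at_right 0. cmod (f z * exp (of_real e * (z\<^sup>2 - 1))) \<le> B"
    using eventually_at_right_less[of 0] by eventually_elim (rule damped)
  from tendsto_upperbound[OF lim this] show ?thesis
    by simp
qed

text \<open>
  Stein interpolation with change of weights, in coordinates.  With \<open>A s\<close> and \<open>C s\<close> the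
  interpolated weights, deform \<open>x\<close> and the functional \<open>u \<mapsto> \<Sum>i. A t i * cnj (T x i) * u i\<close>
  analytically in \<open>z\<close> in such a way that on the line \<open>Re z = s\<close> their norms for the weights
  \<open>C s\<close> and \<open>1 / A s\<close> do not depend on \<open>z\<close>.  The pairing \<open>f z\<close> is bounded by Cauchy-Schwarz on
  both edges of the strip, and its value at \<open>z = t\<close> is the left-hand side.
\<close>

lemma weighted_l2_interpolation:
  fixes T :: "'i \<Rightarrow> 'j \<Rightarrow> complex" and x :: "'j \<Rightarrow> complex"
  assumes a: "\<And>i. i \<in> I \<Longrightarrow> 0 < a i" and b: "\<And>i. i \<in> I \<Longrightarrow> 0 < b i"
    and c: "\<And>j. j \<in> J \<Longrightarrow> 0 < c j" and d: "\<And>j. j \<in> J \<Longrightarrow> 0 < d j"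
    and bound0: "\<And>x. (\<Sum>i\<in>I. a i * (cmod (\<Sum>j\<in>J. T i j * x j))\<^sup>2) \<le> (\<Sum>j\<in>J. c j * (cmod (x j))\<^sup>2)"
    and bound1: "\<And>x. (\<Sum>i\<in>I. b i * (cmod (\<Sum>j\<in>J. T i j * x j))\<^sup>2) \<le> (\<Sum>j\<in>J. d j * (cmod (x j))\<^sup>2)"
    and t: "0 \<le> t" "t \<le> 1"
  shows "(\<Sum>i\<in>I. (a i powr (1 - t) * b i powr t) * (cmod (\<Sum>j\<in>J. T i j * x j))\<^sup>2)
    \<le> (\<Sum>j\<in>J. (c j powr (1 - t) * d j powr t) * (cmod (x j))\<^sup>2)" (is "?N \<le> ?X")
proof -
  define A where "A = (\<lambda>s i. exp ((1 - s) * ln (a i) + s * ln (b i)))"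
  define C where "C = (\<lambda>s j. exp ((1 - s) * ln (c j) + s * ln (d j)))"
  define p where "p = (\<lambda>i. ln (b i) - ln (a i))"
  define q where "q = (\<lambda>j. ln (c j) - ln (d j))"
  define y where "y = (\<lambda>i. \<Sum>j\<in>J. T i j * x j)"
  define xz where "xz = (\<lambda>z j. exp ((z - of_real t) / 2 * of_real (q j)) * x j)"
  define yz where "yz = (\<lambda>z i. exp ((z - of_real t) / 2 * of_real (p i)) * (of_real (A t i) * cnj (y i)))"
  define f where "f = (\<lambda>z. \<Sum>i\<in>I. yz z i * (\<Sum>j\<in>J. T i j * xz z j))"
  have N: "?N = (\<Sum>i\<in>I. A t i * (cmod (y i))\<^sup>2)"
    unfolding y_def A_def using a b by (intro sum.cong) (auto simp: powr_def exp_add less_imp_neq[symmetric])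
  have X: "?X = (\<Sum>j\<in>J. C t j * (cmod (x j))\<^sup>2)"
    unfolding C_def using c d by (intro sum.cong) (auto simp: powr_def exp_add less_imp_neq[symmetric])
  have A_pos: "0 < A s i" for s i by (simp add: A_def)
  have A01: "A 0 i = a i" "A 1 i = b i" if "i \<in> I" for i
    using a b that by (auto simp: A_def)
  have C01: "C 0 j = c j" "C 1 j = d j" if "j \<in> J" for j
    using c d that by (auto simp: C_def)
  have N0: "0 \<le> ?N" and X0: "0 \<le> ?X"
    by (intro sum_nonneg; simp)+
  have cmod_exp: "(cmod (exp ((z - of_real t) / 2 * of_real r)))\<^sup>2 = exp ((Re z - t) * r)" for z r
    by (simp flip: exp_double)
  have xz_norm: "C (Re z) j * (cmod (xz z j))\<^sup>2 = C t j * (cmod (x j))\<^sup>2" for z j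
    unfolding xz_def norm_mult power_mult_distrib cmod_exp
    by (simp add: C_def q_def algebra_simps flip: mult.assoc exp_add)
  have yz_norm: "(cmod (yz z i))\<^sup>2 / A (Re z) i = A t i * (cmod (y i))\<^sup>2" for z i
  proof -
    have "exp ((Re z - t) * p i) * A t i / A (Re z) i = 1"
      by (simp add: A_def p_def algebra_simps flip: exp_add exp_diff)
    moreover have "(cmod (yz z i))\<^sup>2 / A (Re z) i
        = (exp ((Re z - t) * p i) * A t i / A (Re z) i) * (A t i * (cmod (y i))\<^sup>2)"
      unfolding yz_def norm_mult power_mult_distrib cmod_exp
      using A_pos[of t i] by (simp add: power2_eq_square)
    ultimately show ?thesis by simp
  qed
  \<comment> \<open>On either edge, Cauchy-Schwarz with the weight \<open>A (Re z)\<close> and then the assumed bound.\<close>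
  have edge: "cmod (f z) \<le> sqrt (?N * ?X)" if "Re z = 0 \<or> Re z = 1" for z
  proof -
    let ?s = "Re z" and ?u = "\<lambda>i. \<Sum>j\<in>J. T i j * xz z j"
    have "(\<Sum>i\<in>I. A ?s i * (cmod (?u i))\<^sup>2) \<le> (\<Sum>j\<in>J. C ?s j * (cmod (xz z j))\<^sup>2)"
    proof (cases "?s = 0")
      case True
      then show ?thesis using bound0[of "xz z"] by (simp add: A01 C01 cong: sum.cong)
    next
      case False
      then have "?s = 1" using that by simp
      then show ?thesis using bound1[of "xz z"] by (simp add: A01 C01 cong: sum.cong)
    qed
    then have u: "(\<Sum>i\<in>I. A ?s i * (cmod (?u i))\<^sup>2) \<le> ?X"
      unfolding xz_norm X .
    have "cmod (f z) \<le> (\<Sum>i\<in>I. cmod (yz z i) * cmod (?u i))"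
      unfolding f_def by (intro order.trans[OF norm_sum]) (simp add: norm_mult)
    also have "\<dots> = (\<Sum>i\<in>I. \<bar>cmod (yz z i) / sqrt (A ?s i)\<bar> * \<bar>sqrt (A ?s i) * cmod (?u i)\<bar>)"
      using A_pos by (intro sum.cong refl) (simp add: less_imp_neq[symmetric] abs_mult)
    also have "\<dots> \<le> L2_set (\<lambda>i. cmod (yz z i) / sqrt (A ?s i)) I * L2_set (\<lambda>i. sqrt (A ?s i) * cmod (?u i)) I"
      by (rule L2_set_mult_ineq)
    also have "\<dots> = sqrt ?N * sqrt (\<Sum>i\<in>I. A ?s i * (cmod (?u i))\<^sup>2)"
      using A_pos by (simp add: L2_set_def power_mult_distrib power_divide less_imp_le yz_norm N)
    also have "\<dots> \<le> sqrt ?N * sqrt ?X"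
      using u N0 by (intro mult_left_mono) auto
    finally show ?thesis by (simp add: real_sqrt_mult)
  qed
  have "f (of_real t) = of_real ?N"
  proof -
    have "xz (of_real t) = x" by (simp add: xz_def)
    then have "f (of_real t) = (\<Sum>i\<in>I. yz (of_real t) i * y i)" by (simp add: f_def y_def)
    then show ?thesis
      unfolding N by (simp add: yz_def complex_norm_square mult_ac del: of_real_power)
  qed
  moreover have "cmod (f (of_real t)) \<le> sqrt (?N * ?X)"
  proof (rule three_lines[where f = f])
    show "f holomorphic_on {z. 0 < Re z \<and> Re z < 1}"
      unfolding f_def xz_def yz_def by (intro holomorphic_intros) simp_all
    show "continuous_on {z. 0 \<le> Re z \<and> Re z \<le> 1} f"
      unfolding f_def xz_def yz_def by (intro continuous_intros) simp_all
    show "cmod (f z) \<le> (\<Sum>i\<in>I. (exp \<bar>p i\<bar> * cmod (of_real (A t i) * cnj (y i)))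
        * (\<Sum>j\<in>J. cmod (T i j) * (exp \<bar>q j\<bar> * cmod (x j))))" if "0 \<le> Re z" "Re z \<le> 1" for z
    proof -
      have e: "cmod (exp ((z - of_real t) / 2 * of_real r)) \<le> exp \<bar>r\<bar>" for r
      proof -
        have "\<bar>(Re z - t) / 2\<bar> \<le> 1" using that t by auto
        then have "\<bar>(Re z - t) / 2\<bar> * \<bar>r\<bar> \<le> 1 * \<bar>r\<bar>" by (rule mult_right_mono) simp
        then have "(Re z - t) / 2 * r \<le> \<bar>r\<bar>"
          using abs_ge_self[of "(Re z - t) / 2 * r"] by (simp only: abs_mult mult_1)
        then show ?thesis by simp
      qed
      have "cmod (f z) \<le> (\<Sum>i\<in>I. cmod (yz z i) * cmod (\<Sum>j\<in>J. T i j * xz z j))"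
        unfolding f_def by (intro order.trans[OF norm_sum]) (simp add: norm_mult)
      also have "\<dots> \<le> (\<Sum>i\<in>I. (exp \<bar>p i\<bar> * cmod (of_real (A t i) * cnj (y i)))
        * (\<Sum>j\<in>J. cmod (T i j) * (exp \<bar>q j\<bar> * cmod (x j))))"
        unfolding yz_def xz_def
        by (intro sum_mono mult_mono order.trans[OF norm_sum])
          (auto simp only: norm_mult intro!: sum_mono mult_mono e sum_nonneg
            mult_nonneg_nonneg exp_ge_zero norm_ge_zero order.refl)
      finally show ?thesis .
    qed
  qed (use edge t in auto)
  ultimately have "cmod (of_real ?N) \<le> sqrt (?N * ?X)" by (simp only:)
  then have "?N \<le> sqrt (?N * ?X)"
    unfolding norm_of_real using N0 by (simp only: abs_of_nonneg)
  moreover have "u \<le> v" if "0 \<le> u" "0 \<le> v" "u \<le> sqrt (u * v)" for u v :: real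
  proof -
    have "u\<^sup>2 \<le> u * v"
      using that by (intro sqrt_ge_absD) simp
    then show ?thesis
      using that by (cases "u = 0") (auto simp: power2_eq_square)
  qed
  ultimately show ?thesis
    using N0 X0 by blast
qed

lemma mult_diag_mat_entry: "(M ** diag_mat d) $ i $ j = M $ i $ j * of_real (d j)"
  by (simp add: matrix_matrix_mult_def diag_mat_def if_distrib cong: if_cong)

section \<open>Positive matrices\<close>

lemma posdef_imp_psd: "posdef A \<Longrightarrow> psd A"
  by (auto simp: posdef_def psd_def quad_form_cinner intro: less_imp_le)
     (metis cinner_zero_right less_imp_le matrix_vector_mult_0_right order_refl)

lemma psd_congruence: "psd A \<Longrightarrow> psd (cadjoint B ** A ** B)"
  by (auto simp: psd_def hermitian_def quad_form_congruence cadjoint_mult matrix_mul_assoc)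

lemma psd_mat_1: "psd (mat 1)"
  by (simp add: psd_def hermitian_def quad_form_mat_1 less_eq_complex_def)

lemma psd_cadjoint_mult_self: "psd (cadjoint B ** B)"
  using psd_congruence[OF psd_mat_1, of B] by simp

lemma psd_diag_mat: "(\<And>i. 0 \<le> d i) \<Longrightarrow> psd (diag_mat d)"
  by (auto simp: psd_def hermitian_def quad_form_diag_mat less_eq_complex_def intro!: sum_nonneg)

lemma quad_form_hermitian_real:
  assumes "hermitian A"
  shows "Im (quad_form A v) = 0"
proof -
  have "cnj (quad_form A v) = quad_form A v"
    using assms cinner_cadjoint[of v A v]
    by (simp add: quad_form_cinner hermitian_def flip: cinner_commute)
  then show ?thesis by (simp add: complex_eq_iff)
qed

lemma quad_form_mscale: "quad_form (mscale c A) v = c * quad_form A v"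
  by (simp add: quad_form_def mscale_def matrix_vector_mult_def sum_distrib_left mult_ac)

text \<open>
  The numbers \<open>d i\<close> are the values of the quadratic form at the eigenvectors, the columns of \<open>U\<close>;
  this is how positivity of \<open>A\<close> passes to its eigenvalues.
\<close>

lemma unitary_diagonal_entry:
  assumes "unitary U" "A = U ** diag_mat d ** cadjoint U"
  shows "quad_form A (U *v axis i 1) = of_real (d i)"
proof -
  have "quad_form A (U *v axis i 1) = quad_form (cadjoint U ** A ** U) (axis i 1)"
    by (simp add: quad_form_congruence)
  also have "cadjoint U ** A ** U = (cadjoint U ** U) ** diag_mat d ** (cadjoint U ** U)"
    by (simp add: assms(2) matrix_mul_assoc)
  also have "\<dots> = diag_mat d"
    using assms(1) by (simp add: unitary_def)
  finally show ?thesis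
    by (simp add: quad_form_axis diag_mat_def)
qed

lemma unitary_axis_nonzero:
  assumes "unitary U"
  shows "U *v axis i 1 \<noteq> 0"
proof
  assume "U *v axis i 1 = 0"
  then have "cadjoint U *v (U *v axis i 1) = 0" by simp
  then have "axis i (1::complex) = 0"
    using assms by (simp add: matrix_vector_mul_assoc unitary_def)
  then show False by (simp add: axis_eq_0_iff)
qed

lemma psd_diagonalization:
  assumes "psd A"
  obtains U d where "unitary U" "A = U ** diag_mat d ** cadjoint U" "\<And>i. 0 \<le> d i"
proof -
  obtain U d where U: "unitary U" "A = U ** diag_mat d ** cadjoint U"
    using assms hermitian_diagonalization by (metis psd_def)
  have "0 \<le> d i" for i
    using unitary_diagonal_entry[OF U, of i] assms by (simp add: psd_def less_eq_complex_def) (metis Re_complex_of_real)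
  with U that show ?thesis by blast
qed

lemma posdef_diagonalization:
  assumes "posdef A"
  obtains U d where "unitary U" "A = U ** diag_mat d ** cadjoint U" "\<And>i. 0 < d i"
proof -
  obtain U d where U: "unitary U" "A = U ** diag_mat d ** cadjoint U"
    using assms hermitian_diagonalization by (metis posdef_def)
  have "0 < d i" for i
  proof -
    have "0 < quad_form A (U *v axis i 1)"
      using assms unitary_axis_nonzero[OF U(1)] by (simp add: posdef_def)
    then show ?thesis
      using unitary_diagonal_entry[OF U, of i] by (simp add: less_complex_def)
  qed
  with U that show ?thesis by blast
qed

lemma trace_psd_nonneg: "psd A \<Longrightarrow> 0 \<le> trace A"
  by (auto simp: trace_quad_form psd_def less_eq_complex_def intro!: sum_nonneg)

lemma trace_psd_mult_nonneg:
  assumes "psd A" "psd B"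
  shows "0 \<le> trace (A ** B)"
proof -
  obtain U d where U: "unitary U" "B = U ** diag_mat d ** cadjoint U" "\<And>i. 0 \<le> d i"
    using psd_diagonalization[OF assms(2)] by blast
  let ?M = "cadjoint U ** A ** U"
  have "trace (A ** B) = trace (cadjoint U ** (A ** U ** diag_mat d))"
    by (subst trace_mul_sym) (simp add: U(2) matrix_mul_assoc)
  also have "\<dots> = trace (?M ** diag_mat d)"
    by (simp add: matrix_mul_assoc)
  also have "\<dots> = (\<Sum>i\<in>UNIV. quad_form ?M (axis i 1) * of_real (d i))"
    by (simp add: trace_def mult_diag_mat_entry quad_form_axis)
  finally show ?thesis
    using psd_congruence[OF assms(1), of U] U(3)
    by (auto simp: psd_def less_eq_complex_def intro!: sum_nonneg)
qed

lemma posdef_bounded_below: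
  assumes "posdef A"
  obtains \<mu> :: real where "0 < \<mu>" "psd (A - mscale (of_real \<mu>) (mat 1))"
proof -
  obtain U d where U: "unitary U" "A = U ** diag_mat d ** cadjoint U" "\<And>i. 0 < d i"
    using posdef_diagonalization[OF assms] by blast
  let ?\<mu> = "Min (range d)"
  have "diag_mat d = diag_mat (\<lambda>i. d i - ?\<mu>) + mscale (of_real ?\<mu>) (mat 1)"
    by (auto simp: vec_eq_iff diag_mat_def mscale_def mat_def)
  then have "A = U ** diag_mat (\<lambda>i. d i - ?\<mu>) ** cadjoint U + mscale (of_real ?\<mu>) (mat 1)"
    using U(1) unfolding U(2)
    by (simp add: matrix_add_ldistrib matrix_add_rdistrib mscale_mult_left mscale_mult_right unitary_def)
  then have "A - mscale (of_real ?\<mu>) (mat 1) = U ** diag_mat (\<lambda>i. d i - ?\<mu>) ** cadjoint U"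
    by simp
  moreover have "psd (U ** diag_mat (\<lambda>i. d i - ?\<mu>) ** cadjoint U)"
    using psd_congruence[OF psd_diag_mat, of "\<lambda>i. d i - ?\<mu>" "cadjoint U"] by simp
  moreover have "0 < ?\<mu>"
    using U(3) by simp
  ultimately show ?thesis
    using that by metis
qed

text \<open>
  Dominating a positive multiple of \<open>\<one>\<close>, the matrix \<open>B\<close> turns the assumption on the trace of \<open>A\<close> into
  a lower bound.
\<close>

lemma trace_psd_posdef_pos:
  assumes "psd A" "0 < trace A" "posdef B"
  shows "0 < trace (A ** B)"
proof -
  obtain \<mu> :: real where \<mu>: "0 < \<mu>" "psd (B - mscale (of_real \<mu>) (mat 1))"
    using posdef_bounded_below[OF assms(3)] by blast
  have "A ** B = A ** (B - mscale (of_real \<mu>) (mat 1)) + mscale (of_real \<mu>) A"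
    by (simp add: matrix_diff_ldistrib mscale_mult_right)
  then have "trace (A ** B) = trace (A ** (B - mscale (of_real \<mu>) (mat 1))) + of_real \<mu> * trace A"
    by (simp add: trace_add trace_mscale)
  then show ?thesis
    using trace_psd_mult_nonneg[OF assms(1) \<mu>(2)] assms(2) \<mu>(1)
    by (simp add: less_eq_complex_def less_complex_def add_nonneg_pos)
qed

definition outer :: "complex^'n \<Rightarrow> complex^'n^'n" where
  "outer v = (\<chi> i j. v $ i * cnj (v $ j))"

lemma trace_outer_mult: "trace (outer v ** A) = quad_form A v"
proof -
  have "trace (outer v ** A) = (\<Sum>i\<in>UNIV. \<Sum>j\<in>UNIV. v $ i * cnj (v $ j) * A $ j $ i)"
    by (simp add: trace_def matrix_matrix_mult_def outer_def)
  also have "\<dots> = (\<Sum>j\<in>UNIV. \<Sum>i\<in>UNIV. v $ i * cnj (v $ j) * A $ j $ i)"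
    by (rule sum.swap)
  also have "\<dots> = quad_form A v"
    by (simp add: quad_form_def matrix_vector_mult_def sum_distrib_left mult_ac)
  finally show ?thesis .
qed

lemma psd_outer: "psd (outer v)"
proof -
  have "outer v *v w = cinner v w *s v" for w
    by (simp add: vec_eq_iff matrix_vector_mult_def outer_def cinner_def sum_distrib_left
        sum_distrib_right mult_ac)
  then have "quad_form (outer v) w = of_real ((cmod (cinner v w))\<^sup>2)" for w
    by (simp add: quad_form_cinner cinner_scale_right cinner_commute[of w v] complex_norm_square
        del: of_real_power)
  moreover have "hermitian (outer v)"
    by (simp add: hermitian_def cadjoint_def outer_def vec_eq_iff mult.commute)
  ultimately show ?thesis
    by (simp add: psd_def less_eq_complex_def)
qed

text \<open>
  Testing against \<open>outer v + e \<one>\<close>, which is positive definite, and letting \<open>e\<close> tend to 0 recovers the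
  quadratic form at \<open>v\<close>.
\<close>

lemma psd_if_trace_nonneg:
  assumes herm: "hermitian A" and tr: "\<And>X. posdef X \<Longrightarrow> 0 \<le> Re (trace (A ** X))"
  shows "psd A"
proof -
  have "0 \<le> quad_form A v" for v
  proof -
    have "0 \<le> Re (quad_form A v) + e * Re (trace A)" if "0 < e" for e :: real
    proof -
      let ?X = "outer v + mscale (of_real e) (mat 1)"
      have "0 < quad_form ?X w" if "w \<noteq> 0" for w
        using psd_outer[of v] that \<open>0 < e\<close>
        by (simp add: psd_def quad_form_add quad_form_mscale quad_form_mat_1 less_eq_complex_def
            less_complex_def add_nonneg_pos)
      then have "posdef ?X"
        using psd_outer[of v]
        by (simp add: posdef_def psd_def hermitian_def cadjoint_add cadjoint_mscale)
      from tr[OF this] show ?thesis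
        by (simp add: matrix_add_ldistrib trace_add trace_mul_sym[of A] trace_outer_mult
            mscale_mult_left trace_mscale)
    qed
    then have ev: "\<forall>\<^sub>F e in at_right 0. 0 \<le> Re (quad_form A v) + e * Re (trace A)"
      using eventually_at_right_less by (rule eventually_mono[rotated])
    have "((\<lambda>e. Re (quad_form A v) + e * Re (trace A)) \<longlongrightarrow> Re (quad_form A v) + 0 * Re (trace A)) (at_right 0)"
      by (intro tendsto_intros)
    from tendsto_lowerbound[OF this ev] show ?thesis
      using quad_form_hermitian_real[OF herm] by (simp add: less_eq_complex_def)
  qed
  with herm show ?thesis by (simp add: psd_def)
qed

section \<open>Powers of positive definite matrices\<close>

lemma matrix_powr_diagonal:
  assumes "unitary U" "A = U ** diag_mat d ** cadjoint U"
  shows "matrix_powr A s = U ** diag_mat (\<lambda>i. d i powr s) ** cadjoint U"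
  unfolding matrix_powr_def by (rule matrix_fun_eq[OF assms])

lemma diag_mat_one: "diag_mat (\<lambda>i. 1) = mat 1"
  by (auto simp: diag_mat_def mat_def vec_eq_iff)

lemma diag_mat_mult: "diag_mat d ** diag_mat e = diag_mat (\<lambda>i. d i * e i)"
  unfolding vec_eq_iff mult_diag_mat_entry by (simp add: diag_mat_def)

text \<open>
  Definiteness matters: \<open>0 powr 0 = 0\<close>, so that the power 0 of a singular positive matrix is the
  projection onto its range.
\<close>

lemma matrix_powr_0:
  assumes "posdef A"
  shows "matrix_powr A 0 = mat 1"
proof -
  obtain U d where U: "unitary U" "A = U ** diag_mat d ** cadjoint U" "\<And>i. 0 < d i"
    using posdef_diagonalization[OF assms] by blast
  show ?thesis
    unfolding matrix_powr_diagonal[OF U(1,2)]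
    using U(1,3) by (simp add: less_imp_neq[symmetric] diag_mat_one unitary_def)
qed

lemma matrix_powr_minus_1:
  assumes "posdef A"
  shows "A ** matrix_powr A (- 1) = mat 1" "matrix_powr A (- 1) ** A = mat 1"
    and "psd (matrix_powr A (- 1))"
proof -
  obtain U d where U: "unitary U" "A = U ** diag_mat d ** cadjoint U" "\<And>i. 0 < d i"
    using posdef_diagonalization[OF assms] by blast
  have "A ** matrix_powr A (- 1)
      = U ** diag_mat d ** (cadjoint U ** U) ** diag_mat (\<lambda>i. d i powr - 1) ** cadjoint U"
    unfolding matrix_powr_diagonal[OF U(1,2)] by (simp add: U(2) matrix_mul_assoc)
  also have "\<dots> = U ** (diag_mat d ** diag_mat (\<lambda>i. d i powr - 1)) ** cadjoint U"
    using U(1) by (simp add: unitary_def matrix_mul_assoc)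
  also have "diag_mat d ** diag_mat (\<lambda>i. d i powr - 1) = mat 1"
    using U(3) by (simp add: diag_mat_mult powr_minus_divide less_imp_neq[symmetric] less_imp_le diag_mat_one)
  finally show *: "A ** matrix_powr A (- 1) = mat 1"
    using U(1) by (simp add: unitary_def)
  then show "matrix_powr A (- 1) ** A = mat 1"
    by (simp add: matrix_left_right_inverse)
  show "psd (matrix_powr A (- 1))"
    using psd_congruence[OF psd_diag_mat, of "\<lambda>i. d i powr - 1" "cadjoint U"]
    by (simp add: matrix_powr_diagonal[OF U(1,2)])
qed

text \<open>
  Lieb's function, which for \<open>0 \<le> t \<le> 1\<close> and fixed \<open>K\<close> is jointly convex in the positive definite
  matrices \<open>X\<close> and \<open>Y\<close>.
\<close>

definition lieb_trace :: "complex^'n^'n \<Rightarrow> complex^'n^'n \<Rightarrow> complex^'n^'n \<Rightarrow> real \<Rightarrow> complex" where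
  "lieb_trace K Y X t = trace (cadjoint K ** matrix_powr Y (t - 1) ** K ** matrix_powr X (- t))"

lemma lieb_trace_1:
  assumes "posdef Y"
  shows "lieb_trace K Y X 1 = trace (K ** matrix_powr X (- 1) ** cadjoint K)"
  using assms trace_mul_sym[of "cadjoint K" "K ** matrix_powr X (- 1)"]
  by (simp add: lieb_trace_def matrix_powr_0 matrix_mul_assoc)

lemma lieb_trace_0:
  assumes "posdef X"
  shows "lieb_trace K Y X 0 = trace (cadjoint K ** matrix_powr Y (- 1) ** K)"
  using assms by (simp add: lieb_trace_def matrix_powr_0)

text \<open>
  In eigenbases of \<open>Y\<close> and \<open>X\<close> the function is a weighted sum of squares of the coordinates of
  \<open>K\<close>, and the weight at \<open>t\<close> is the geometric mean of the weights at 0 and 1, taken with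
  exponents \<open>1 - t\<close> and \<open>t\<close>.
\<close>

lemma lieb_trace_diagonal:
  assumes U: "unitary U" "Y = U ** diag_mat y ** cadjoint U" "\<And>i. 0 < y i"
    and V: "unitary V" "X = V ** diag_mat x ** cadjoint V" "\<And>i. 0 < x i"
  shows "lieb_trace K Y X t = of_real (\<Sum>(i, j)\<in>UNIV.
    ((1 / y i) powr (1 - t) * (1 / x j) powr t) * (cmod ((cadjoint U ** K ** V) $ i $ j))\<^sup>2)"
proof -
  let ?L = "cadjoint U ** K ** V"
  let ?a = "\<lambda>i. y i powr (t - 1)" and ?b = "\<lambda>j. x j powr - t"
  have "lieb_trace K Y X t
      = trace ((cadjoint K ** U ** diag_mat ?a ** cadjoint U ** K ** V ** diag_mat ?b) ** cadjoint V)"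
    by (simp add: lieb_trace_def matrix_powr_diagonal[OF U(1,2)] matrix_powr_diagonal[OF V(1,2)]
        matrix_mul_assoc)
  also have "\<dots> = trace ((cadjoint ?L ** diag_mat ?a) ** (?L ** diag_mat ?b))"
    by (subst trace_mul_sym) (simp add: cadjoint_mult matrix_mul_assoc)
  also have "\<dots> = (\<Sum>j\<in>UNIV. \<Sum>i\<in>UNIV. (cadjoint ?L ** diag_mat ?a) $ j $ i * (?L ** diag_mat ?b) $ i $ j)"
    by (simp add: trace_def matrix_matrix_mult_def[of "cadjoint ?L ** diag_mat ?a"])
  also have "\<dots> = (\<Sum>j\<in>UNIV. \<Sum>i\<in>UNIV. of_real (?a i * ?b j * (cmod (?L $ i $ j))\<^sup>2))"
    unfolding mult_diag_mat_entry cadjoint_def[of ?L]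
    by (simp add: complex_norm_square mult_ac del: of_real_power)
  also have "\<dots> = of_real (\<Sum>i\<in>UNIV. \<Sum>j\<in>UNIV. ?a i * ?b j * (cmod (?L $ i $ j))\<^sup>2)"
    by (subst sum.swap) simp
  also have "(\<lambda>i j. ?a i * ?b j) = (\<lambda>i j. (1 / y i) powr (1 - t) * (1 / x j) powr t)"
    using U(3) V(3) by (auto simp: fun_eq_iff powr_divide powr_minus_divide powr_diff less_imp_le)
  finally show ?thesis
    by (simp add: sum.cartesian_product flip: UNIV_Times_UNIV)
qed

section \<open>Positive linear maps and their adjoints\<close>

lemma matrix_linear_diff:
  assumes "matrix_linear \<Phi>"
  shows "\<Phi> (A - B) = \<Phi> A - \<Phi> B"
proof -
  have "\<Phi> ((A - B) + B) = \<Phi> (A - B) + \<Phi> B"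
    using assms unfolding matrix_linear_iff by blast
  then show ?thesis by (simp add: algebra_simps)
qed

text \<open>
  A Hermitian matrix is a difference of positive ones:
  \<open>4 H = (H + \<one>)\<^sup>2 - (H - \<one>)\<^sup>2\<close>.
\<close>

lemma positive_map_hermitian:
  fixes \<Phi> :: "complex^'n^'n \<Rightarrow> complex^'m^'m"
  assumes \<Phi>: "positive_map \<Phi>" and H: "hermitian H"
  shows "hermitian (\<Phi> H)"
proof -
  have lin: "matrix_linear \<Phi>" and pos: "\<And>X. psd X \<Longrightarrow> hermitian (\<Phi> X)"
    using \<Phi> by (auto simp: positive_map_def psd_def)
  have "mscale 4 H = cadjoint (H + mat 1) ** (H + mat 1) - cadjoint (H - mat 1) ** (H - mat 1)"
    using H by (simp add: hermitian_def cadjoint_add cadjoint_diff matrix_add_ldistrib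
        matrix_add_rdistrib matrix_diff_ldistrib matrix_diff_rdistrib)
      (simp add: mscale_def vec_eq_iff)
  moreover have "hermitian (\<Phi> (cadjoint A ** A - cadjoint B ** B))" for A B :: "complex^'n^'n"
    using pos[OF psd_cadjoint_mult_self[of A]] pos[OF psd_cadjoint_mult_self[of B]]
    by (simp add: matrix_linear_diff[OF lin] hermitian_def cadjoint_diff)
  ultimately have "hermitian (\<Phi> (mscale 4 H))" by metis
  moreover have "\<Phi> H = mscale (1 / 4) (\<Phi> (mscale 4 H))"
    using lin by (simp add: matrix_linear_iff mscale_mscale)
  ultimately show ?thesis
    by (metis (no_types, lifting) cadjoint_mscale complex_cnj_divide complex_cnj_numeral complex_cnj_one hermitian_def)
qed

lemma positive_map_cadjoint:
  assumes \<Phi>: "positive_map \<Phi>"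
  shows "\<Phi> (cadjoint K) = cadjoint (\<Phi> K)"
proof -
  have lin: "matrix_linear \<Phi>"
    using \<Phi> by (simp add: positive_map_def)
  have add: "\<Phi> (A + B) = \<Phi> A + \<Phi> B" and scale: "\<Phi> (mscale c A) = mscale c (\<Phi> A)" for c A B
    using lin by (auto simp: matrix_linear_iff)
  define P where "P = mscale (1 / 2) (K + cadjoint K)"
  define Q where "Q = mscale (\<i> / 2) (cadjoint K - K)"
  have PQ: "hermitian P" "hermitian Q"
    by (simp_all add: P_def Q_def hermitian_def cadjoint_def mscale_def vec_eq_iff algebra_simps)
  have K: "K = P + mscale \<i> Q" "cadjoint K = P + mscale (- \<i>) Q"
    by (simp_all add: P_def Q_def cadjoint_def mscale_def vec_eq_iff field_simps)
  have "\<Phi> (cadjoint K) = \<Phi> P + mscale (- \<i>) (\<Phi> Q)"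
    by (simp only: K(2) add scale)
  also have "\<dots> = cadjoint (\<Phi> P + mscale \<i> (\<Phi> Q))"
    using positive_map_hermitian[OF \<Phi> PQ(1)] positive_map_hermitian[OF \<Phi> PQ(2)]
    by (simp add: hermitian_def cadjoint_add cadjoint_mscale)
  also have "\<Phi> P + mscale \<i> (\<Phi> Q) = \<Phi> K"
    by (subst K(1)) (simp only: add scale)
  finally show ?thesis .
qed

lemma trace_hs_adjoint:
  assumes "positive_map \<Phi>"
  shows "trace (\<Phi> A ** Y) = trace (A ** hs_adjoint \<Phi> Y)"
  using hs_adjoint_works[of \<Phi> "cadjoint A" Y] assms
  by (simp add: hs_inner_def positive_map_cadjoint positive_map_def)

lemma hs_adjoint_cadjoint:
  assumes "positive_map \<Phi>"
  shows "hs_adjoint \<Phi> (cadjoint K) = cadjoint (hs_adjoint \<Phi> K)"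
proof (rule hs_inner_eqI)
  fix X
  have "hs_inner X (hs_adjoint \<Phi> (cadjoint K)) = trace (\<Phi> (cadjoint X) ** cadjoint K)"
    by (simp add: hs_inner_def trace_hs_adjoint[OF assms])
  also have "\<dots> = cnj (trace (K ** \<Phi> X))"
    by (simp add: positive_map_cadjoint[OF assms] cadjoint_mult flip: trace_cadjoint)
  also have "trace (K ** \<Phi> X) = trace (X ** hs_adjoint \<Phi> K)"
    by (subst trace_mul_sym) (rule trace_hs_adjoint[OF assms])
  also have "\<dots> = trace (hs_adjoint \<Phi> K ** X)"
    by (rule trace_mul_sym)
  finally show "hs_inner X (hs_adjoint \<Phi> (cadjoint K)) = hs_inner X (cadjoint (hs_adjoint \<Phi> K))"
    by (simp add: hs_inner_def cadjoint_mult flip: trace_cadjoint)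
qed

lemma hs_inner_add_right: "hs_inner X (A + B) = hs_inner X A + hs_inner X B"
  by (simp add: hs_inner_def matrix_add_ldistrib trace_add)

lemma hs_inner_mscale_right: "hs_inner X (mscale c A) = c * hs_inner X A"
  by (simp add: hs_inner_def mscale_mult_right trace_mscale)

lemma hs_adjoint_linear:
  assumes "matrix_linear \<Phi>"
  shows "matrix_linear (hs_adjoint \<Phi>)"
  unfolding matrix_linear_iff
  by (auto intro!: hs_inner_eqI simp: hs_adjoint_works[OF assms, symmetric]
      hs_inner_add_right hs_inner_mscale_right)

text \<open>
  The quadratic form of the image of \<open>X\<close> at \<open>v\<close> is the trace of \<open>\<Phi> (outer v) ** X\<close>, and
  for \<open>X = \<one>\<close> the assumption on the image of \<open>\<one>\<close> says that \<open>\<Phi> (outer v)\<close> has positive trace.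
\<close>

lemma hs_adjoint_posdef:
  assumes \<Phi>: "positive_map \<Phi>" and unit: "posdef (hs_adjoint \<Phi> (mat 1))" and X: "posdef X"
  shows "posdef (hs_adjoint \<Phi> X)"
proof -
  have "0 < quad_form (hs_adjoint \<Phi> X) v" if "v \<noteq> 0" for v
  proof -
    have dual: "quad_form (hs_adjoint \<Phi> Y) v = trace (\<Phi> (outer v) ** Y)" for Y
      by (simp add: trace_hs_adjoint[OF \<Phi>] trace_outer_mult)
    have "psd (\<Phi> (outer v))"
      using \<Phi> psd_outer by (auto simp: positive_map_def)
    moreover have "0 < trace (\<Phi> (outer v))"
    proof -
      have "0 < quad_form (hs_adjoint \<Phi> (mat 1)) v"
        using unit that by (simp add: posdef_def)
      then show ?thesis by (simp add: dual)
    qed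
    ultimately show ?thesis
      unfolding dual using X by (rule trace_psd_posdef_pos)
  qed
  moreover have "hermitian (hs_adjoint \<Phi> X)"
    using X hs_adjoint_cadjoint[OF \<Phi>, of X] by (simp add: posdef_def hermitian_def)
  ultimately show ?thesis by (simp add: posdef_def)
qed

section \<open>The Schwarz inequality and its dual form\<close>

text \<open>
  The trace of \<open>P Z\<^sup>-\<^sup>1 P\<^sup>*\<close> is the largest value of a concave quadratic function of \<open>A\<close>, because the
  difference is the trace of \<open>(P - A Z) Z\<^sup>-\<^sup>1 (P - A Z)\<^sup>*\<close>; the maximum is at \<open>A = P Z\<^sup>-\<^sup>1\<close>.
\<close>

lemma completing_square:
  assumes Z: "posdef Z"
  shows "0 \<le> Re (trace (P ** matrix_powr Z (- 1) ** cadjoint P)) - Re (trace (P ** cadjoint A))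
    - Re (trace (A ** cadjoint P)) + Re (trace (A ** Z ** cadjoint A))" (is "0 \<le> ?R")
proof -
  let ?W = "matrix_powr Z (- 1)"
  have herm: "cadjoint Z = Z"
    using Z by (simp add: posdef_def hermitian_def)
  have "trace ((P - A ** Z) ** ?W ** cadjoint (P - A ** Z))
      = trace (P ** ?W ** cadjoint P) - trace (P ** (?W ** Z) ** cadjoint A)
        - trace (A ** (Z ** ?W) ** cadjoint P) + trace (A ** (Z ** ?W) ** Z ** cadjoint A)"
    by (simp add: cadjoint_diff cadjoint_mult herm matrix_diff_ldistrib matrix_diff_rdistrib
        trace_sub matrix_mul_assoc)
  also have "\<dots> = trace (P ** ?W ** cadjoint P) - trace (P ** cadjoint A)
        - trace (A ** cadjoint P) + trace (A ** Z ** cadjoint A)"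
    by (simp only: matrix_powr_minus_1[OF Z] matrix_mul_rid)
  finally have "Re (trace ((P - A ** Z) ** ?W ** cadjoint (P - A ** Z))) = ?R" by simp
  moreover have "psd ((P - A ** Z) ** ?W ** cadjoint (P - A ** Z))"
    using psd_congruence[OF matrix_powr_minus_1(3)[OF Z], of "cadjoint (P - A ** Z)"] by simp
  then have "0 \<le> Re (trace ((P - A ** Z) ** ?W ** cadjoint (P - A ** Z)))"
    using trace_psd_nonneg by (auto simp: less_eq_complex_def)
  ultimately show ?thesis by simp
qed

text \<open>
  These identities translate the quadratic function of \<open>A\<close> in the preceding lemma, taken for
  \<open>P = hs_adjoint \<Phi> K\<close> and \<open>Z = hs_adjoint \<Phi> X\<close>, into expressions in \<open>\<Phi>\<close>.
\<close>

lemma trace_hs_adjoint_cross: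
  assumes \<Phi>: "positive_map \<Phi>"
  shows "trace (hs_adjoint \<Phi> K ** cadjoint A) = trace (K ** cadjoint (\<Phi> A))"
    and "trace (A ** cadjoint (hs_adjoint \<Phi> K)) = trace (\<Phi> A ** cadjoint K)"
    and "trace (A ** hs_adjoint \<Phi> X ** cadjoint A) = trace (\<Phi> (cadjoint A ** A) ** X)"
proof -
  show "trace (hs_adjoint \<Phi> K ** cadjoint A) = trace (K ** cadjoint (\<Phi> A))"
    by (simp add: trace_mul_sym[of _ "cadjoint A"] trace_mul_sym[of K] trace_hs_adjoint[OF \<Phi>]
        flip: positive_map_cadjoint[OF \<Phi>])
  show "trace (A ** cadjoint (hs_adjoint \<Phi> K)) = trace (\<Phi> A ** cadjoint K)"
    by (simp add: trace_hs_adjoint[OF \<Phi>] hs_adjoint_cadjoint[OF \<Phi>])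
  show "trace (A ** hs_adjoint \<Phi> X ** cadjoint A) = trace (\<Phi> (cadjoint A ** A) ** X)"
    by (simp add: trace_hs_adjoint[OF \<Phi>] trace_mul_sym[of _ "cadjoint A"] matrix_mul_assoc)
qed

text \<open>
  At the optimal \<open>A\<close> the left-hand side equals the quadratic function for \<open>hs_adjoint \<Phi> K\<close> and
  \<open>hs_adjoint \<Phi> X\<close>.  Written in terms of \<open>\<Phi>\<close>, its quadratic part is minus the trace of
  \<open>\<Phi> (A\<^sup>* A) X\<close>, which the Schwarz inequality bounds above by minus the trace of
  \<open>\<Phi> A X (\<Phi> A)\<^sup>*\<close>.  What results is the quadratic function for \<open>K\<close> and \<open>X\<close> at the point \<open>\<Phi> A\<close>.
\<close>

lemma schwarz_map_imp_dual:
  assumes \<Phi>: "positive_map \<Phi>" "posdef (hs_adjoint \<Phi> (mat 1))" and schwarz: "schwarz_map \<Phi>"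
    and X: "posdef X"
  shows "Re (trace (hs_adjoint \<Phi> K ** matrix_powr (hs_adjoint \<Phi> X) (- 1) ** cadjoint (hs_adjoint \<Phi> K)))
    \<le> Re (trace (K ** matrix_powr X (- 1) ** cadjoint K))"
proof -
  let ?P = "hs_adjoint \<Phi> K" and ?Z = "hs_adjoint \<Phi> X"
  define W where "W = matrix_powr ?Z (- 1)"
  have Z: "posdef ?Z" by (rule hs_adjoint_posdef[OF \<Phi> X])
  \<comment> \<open>the maximizer in \<open>completing_square\<close>\<close>
  define A where "A = ?P ** W"
  have W: "?Z ** W = mat 1" "W ** ?Z = mat 1" "cadjoint W = W"
    using matrix_powr_minus_1[OF Z] by (auto simp: W_def psd_def hermitian_def)
  have AZ: "A ** ?Z = ?P"
    using W by (simp add: A_def flip: matrix_mul_assoc)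
  have APA: "?P ** cadjoint A = A ** cadjoint ?P"
    by (simp add: A_def cadjoint_mult W matrix_mul_assoc)
  have "trace (cadjoint (\<Phi> A) ** \<Phi> A ** X) = trace (\<Phi> A ** X ** cadjoint (\<Phi> A))"
    using trace_mul_sym[of "cadjoint (\<Phi> A)" "\<Phi> A ** X"] by (simp add: matrix_mul_assoc)
  moreover have "0 \<le> trace ((\<Phi> (cadjoint A ** A) - cadjoint (\<Phi> A) ** \<Phi> A) ** X)"
    using schwarz posdef_imp_psd[OF X]
    by (intro trace_psd_mult_nonneg) (auto simp: schwarz_map_def matrix_le_def)
  ultimately have "Re (trace (\<Phi> A ** X ** cadjoint (\<Phi> A))) \<le> Re (trace (\<Phi> (cadjoint A ** A) ** X))"
    by (simp add: matrix_diff_rdistrib trace_sub less_eq_complex_def)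
  moreover have "trace (\<Phi> (cadjoint A ** A) ** X) = trace (A ** cadjoint ?P)"
    using trace_hs_adjoint_cross(3)[OF \<Phi>(1), of A X] by (simp add: AZ APA)
  moreover have "trace (K ** cadjoint (\<Phi> A)) = trace (A ** cadjoint ?P)"
    "trace (\<Phi> A ** cadjoint K) = trace (A ** cadjoint ?P)"
    using trace_hs_adjoint_cross(1)[OF \<Phi>(1), of K A] trace_hs_adjoint_cross(2)[OF \<Phi>(1), of A K]
    by (simp_all add: APA)
  ultimately show ?thesis
    using completing_square[OF X, of K "\<Phi> A"] by (simp flip: W_def A_def)
qed

text \<open>
  For given \<open>A\<close>, the choice \<open>K = \<Phi> A X\<close> makes \<open>\<Phi> A\<close> the optimal point for \<open>K\<close> and \<open>X\<close>, so the
  preceding estimates can be read backwards: \<open>\<Phi> (A\<^sup>* A) - (\<Phi> A)\<^sup>* \<Phi> A\<close> has nonnegative trace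
  against every positive definite \<open>X\<close>.
\<close>

lemma schwarz_map_if_dual:
  assumes \<Phi>: "positive_map \<Phi>" "posdef (hs_adjoint \<Phi> (mat 1))"
    and dual: "\<And>K X. posdef X \<Longrightarrow>
      Re (trace (hs_adjoint \<Phi> K ** matrix_powr (hs_adjoint \<Phi> X) (- 1) ** cadjoint (hs_adjoint \<Phi> K)))
        \<le> Re (trace (K ** matrix_powr X (- 1) ** cadjoint K))"
  shows "schwarz_map \<Phi>"
proof -
  have "psd (\<Phi> (cadjoint A ** A) - cadjoint (\<Phi> A) ** \<Phi> A)" for A
  proof (rule psd_if_trace_nonneg)
    show "hermitian (\<Phi> (cadjoint A ** A) - cadjoint (\<Phi> A) ** \<Phi> A)"
      by (simp add: hermitian_def cadjoint_diff cadjoint_mult flip: positive_map_cadjoint[OF \<Phi>(1)])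
    fix X :: "complex^'b^'b" assume X: "posdef X"
    define K where "K = \<Phi> A ** X"
    let ?T = "trace (\<Phi> A ** X ** cadjoint (\<Phi> A))"
    have cK: "cadjoint K = X ** cadjoint (\<Phi> A)"
      using X by (simp add: K_def cadjoint_mult posdef_def hermitian_def)
    have "K ** matrix_powr X (- 1) ** cadjoint K = \<Phi> A ** (X ** matrix_powr X (- 1)) ** cadjoint K"
      by (simp add: K_def matrix_mul_assoc)
    then have "trace (K ** matrix_powr X (- 1) ** cadjoint K) = ?T"
      by (simp add: matrix_powr_minus_1[OF X] cK matrix_mul_assoc)
    moreover have "trace (K ** cadjoint (\<Phi> A)) = ?T" "trace (\<Phi> A ** cadjoint K) = ?T"
      by (simp_all only: cK) (simp_all add: K_def matrix_mul_assoc)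
    ultimately have "Re ?T \<le> Re (trace (\<Phi> (cadjoint A ** A) ** X))"
      using dual[OF X, of K] completing_square[OF hs_adjoint_posdef[OF \<Phi> X], of "hs_adjoint \<Phi> K" A]
      by (simp add: trace_hs_adjoint_cross[OF \<Phi>(1)])
    moreover have "trace (cadjoint (\<Phi> A) ** \<Phi> A ** X) = ?T"
      using trace_mul_sym[of "cadjoint (\<Phi> A)" "\<Phi> A ** X"] by (simp add: matrix_mul_assoc)
    ultimately show "0 \<le> Re (trace ((\<Phi> (cadjoint A ** A) - cadjoint (\<Phi> A) ** \<Phi> A) ** X))"
      by (simp add: matrix_diff_rdistrib trace_sub)
  qed
  then show ?thesis
    using \<Phi>(1) by (simp add: schwarz_map_def positive_map_def matrix_le_def)
qed

section \<open>Interpolation of the trace inequality\<close>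

definition matrix_unit :: "'n \<Rightarrow> 'n \<Rightarrow> complex^'n^'n" where
  "matrix_unit k l = (\<chi> i j. if i = k \<and> j = l then 1 else 0)"

lemma matrix_linear_expansion:
  assumes "matrix_linear g"
  shows "g L $ i $ j = (\<Sum>(k, l)\<in>UNIV. g (matrix_unit k l) $ i $ j * L $ k $ l)"
proof -
  interpret Vector_Spaces.linear mscale mscale g by (rule assms)
  have "L = (\<Sum>l\<in>UNIV. \<Sum>k\<in>UNIV. mscale (L $ k $ l) (matrix_unit k l))"
  proof -
    have "(\<Sum>l\<in>UNIV. \<Sum>k\<in>UNIV. mscale (L $ k $ l) (matrix_unit k l)) $ i $ j
        = (\<Sum>l\<in>UNIV. \<Sum>k\<in>UNIV. if k = i \<and> l = j then L $ k $ l else 0)" for i j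
      unfolding sum_component by (intro sum.cong) (auto simp: mscale_def matrix_unit_def)
    then show ?thesis by (simp add: vec_eq_iff sum_delta2)
  qed
  then have "g L = (\<Sum>l\<in>UNIV. \<Sum>k\<in>UNIV. mscale (L $ k $ l) (g (matrix_unit k l)))"
    by (metis (no_types, lifting) sum scale sum.cong)
  then have "g L $ i $ j = (\<Sum>l\<in>UNIV. \<Sum>k\<in>UNIV. g (matrix_unit k l) $ i $ j * L $ k $ l)"
    by (simp add: mscale_def mult.commute)
  then show ?thesis
    by (subst (asm) sum.swap) (simp add: sum.cartesian_product flip: UNIV_Times_UNIV)
qed

text \<open>
  In eigenbases of the four positive definite matrices, the two endpoint inequalities say that the
  coordinate form of \<open>\<Psi>\<close> is a contraction between weighted \<open>\<ell>\<^sup>2\<close> spaces for two pairs of weights, and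
  the claim is the same for the interpolated weights.
\<close>

lemma lieb_trace_interpolation:
  fixes \<Psi> :: "complex^'m^'m \<Rightarrow> complex^'n^'n"
  assumes lin: "matrix_linear \<Psi>"
    and pos: "posdef X" "posdef Y" "posdef (\<Psi> X)" "posdef (\<Psi> Y)"
    and end0: "\<And>K. Re (lieb_trace (\<Psi> K) (\<Psi> Y) (\<Psi> X) 0) \<le> Re (lieb_trace K Y X 0)"
    and end1: "\<And>K. Re (lieb_trace (\<Psi> K) (\<Psi> Y) (\<Psi> X) 1) \<le> Re (lieb_trace K Y X 1)"
    and t: "0 \<le> t" "t \<le> 1"
  shows "lieb_trace (\<Psi> K) (\<Psi> Y) (\<Psi> X) t \<le> lieb_trace K Y X t"
proof -
  obtain V x where V: "unitary V" "X = V ** diag_mat x ** cadjoint V" "\<And>i. 0 < x i"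
    using posdef_diagonalization[OF pos(1)] by blast
  obtain U y where U: "unitary U" "Y = U ** diag_mat y ** cadjoint U" "\<And>i. 0 < y i"
    using posdef_diagonalization[OF pos(2)] by blast
  obtain V' x' where V': "unitary V'" "\<Psi> X = V' ** diag_mat x' ** cadjoint V'" "\<And>i. 0 < x' i"
    using posdef_diagonalization[OF pos(3)] by blast
  obtain U' y' where U': "unitary U'" "\<Psi> Y = U' ** diag_mat y' ** cadjoint U'" "\<And>i. 0 < y' i"
    using posdef_diagonalization[OF pos(4)] by blast
  define g where "g = (\<lambda>L. cadjoint U' ** \<Psi> (U ** L ** cadjoint V) ** V')"
  define T where "T = (\<lambda>(i, j) (k, l). g (matrix_unit k l) $ i $ j)"
  have "matrix_linear g"
    using lin unfolding matrix_linear_iff g_def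
    by (simp add: matrix_add_ldistrib matrix_add_rdistrib mscale_mult_left mscale_mult_right)
  then have T: "(\<Sum>q\<in>UNIV. T p q * h q) = g (\<chi> k l. h (k, l)) $ fst p $ snd p" for p h
    by (cases p) (simp add: matrix_linear_expansion[of g] T_def case_prod_unfold)
  \<comment> \<open>In the eigenbases, the coordinates of \<open>K\<close> and \<open>\<Psi> K\<close> are related by \<open>g\<close>.\<close>
  have src: "Re (lieb_trace (U ** L ** cadjoint V) Y X s)
      = (\<Sum>q\<in>UNIV. ((1 / y (fst q)) powr (1 - s) * (1 / x (snd q)) powr s) * (cmod (L $ fst q $ snd q))\<^sup>2)"
    for L s
  proof -
    have "cadjoint U ** (U ** L ** cadjoint V) ** V = (cadjoint U ** U) ** L ** (cadjoint V ** V)"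
      by (simp add: matrix_mul_assoc)
    then show ?thesis
      using U(1) V(1) by (simp add: lieb_trace_diagonal[OF U V] unitary_def case_prod_unfold)
  qed
  have tgt: "Re (lieb_trace (\<Psi> (U ** L ** cadjoint V)) (\<Psi> Y) (\<Psi> X) s)
      = (\<Sum>p\<in>UNIV. ((1 / y' (fst p)) powr (1 - s) * (1 / x' (snd p)) powr s) * (cmod (g L $ fst p $ snd p))\<^sup>2)"
    for L s
    by (simp add: lieb_trace_diagonal[OF U' V'] g_def case_prod_unfold)
  define L where "L = cadjoint U ** K ** V"
  have "U ** L ** cadjoint V = (U ** cadjoint U) ** K ** (V ** cadjoint V)"
    by (simp add: L_def matrix_mul_assoc)
  then have K: "K = U ** L ** cadjoint V"
    using U(1) V(1) by (simp add: unitary_def)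
  define h where "h = (\<lambda>q. L $ fst q $ snd q)"
  have "(\<Sum>p\<in>UNIV. ((1 / y' (fst p)) powr (1 - t) * (1 / x' (snd p)) powr t) * (cmod (\<Sum>q\<in>UNIV. T p q * h q))\<^sup>2)
    \<le> (\<Sum>q\<in>UNIV. ((1 / y (fst q)) powr (1 - t) * (1 / x (snd q)) powr t) * (cmod (h q))\<^sup>2)"
  proof (rule weighted_l2_interpolation)
    fix h :: "'m \<times> 'm \<Rightarrow> complex"
    let ?L = "\<chi> k l. h (k, l)"
    show "(\<Sum>p\<in>UNIV. (1 / y' (fst p)) * (cmod (\<Sum>q\<in>UNIV. T p q * h q))\<^sup>2)
        \<le> (\<Sum>q\<in>UNIV. (1 / y (fst q)) * (cmod (h q))\<^sup>2)"
      using end0[of "U ** ?L ** cadjoint V"] U(3) U'(3) V(3) V'(3) unfolding src tgt T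
      by (simp add: less_imp_neq[symmetric] less_imp_le)
    show "(\<Sum>p\<in>UNIV. (1 / x' (snd p)) * (cmod (\<Sum>q\<in>UNIV. T p q * h q))\<^sup>2)
        \<le> (\<Sum>q\<in>UNIV. (1 / x (snd q)) * (cmod (h q))\<^sup>2)"
      using end1[of "U ** ?L ** cadjoint V"] U(3) U'(3) V(3) V'(3) unfolding src tgt T
      by (simp add: less_imp_neq[symmetric] less_imp_le)
  qed (use U(3) U'(3) V(3) V'(3) t in auto)
  then have "Re (lieb_trace (\<Psi> K) (\<Psi> Y) (\<Psi> X) t) \<le> Re (lieb_trace K Y X t)"
    unfolding K src tgt T by (simp add: h_def)
  then show ?thesis
    by (simp add: less_eq_complex_def lieb_trace_diagonal[OF U V] lieb_trace_diagonal[OF U' V'])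
qed

section \<open>The characterization of Schwarz maps\<close>

theorem theorem1p7:
  fixes \<Phi> :: "complex^'n^'n \<Rightarrow> complex^'m^'m"
  assumes "positive_map \<Phi>"
    and "posdef (hs_adjoint \<Phi> (mat 1))"
  shows "(\<forall>t X Y K. 0 \<le> t \<longrightarrow> t \<le> 1 \<longrightarrow> posdef X \<longrightarrow> posdef Y \<longrightarrow>
            trace (hs_adjoint \<Phi> (cadjoint K) ** matrix_powr (hs_adjoint \<Phi> Y) (t - 1)
                     ** hs_adjoint \<Phi> K ** matrix_powr (hs_adjoint \<Phi> X) (- t))
            \<le> trace (cadjoint K ** matrix_powr Y (t - 1) ** K ** matrix_powr X (- t)))
         \<longleftrightarrow> schwarz_map \<Phi>"
proof -
  let ?\<Psi> = "hs_adjoint \<Phi>"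
  have pd: "posdef (?\<Psi> X)" if "posdef X" for X
    using hs_adjoint_posdef[OF assms that] .
  have "(\<forall>t X Y K. 0 \<le> t \<longrightarrow> t \<le> 1 \<longrightarrow> posdef X \<longrightarrow> posdef Y \<longrightarrow>
      lieb_trace (?\<Psi> K) (?\<Psi> Y) (?\<Psi> X) t \<le> lieb_trace K Y X t) \<longleftrightarrow> schwarz_map \<Phi>"
    (is "?L \<longleftrightarrow> _")
  proof
    assume L: ?L
    show "schwarz_map \<Phi>"
    proof (rule schwarz_map_if_dual[OF assms])
      fix K X :: "complex^'m^'m" assume X: "posdef X"
      with L have "lieb_trace (?\<Psi> K) (?\<Psi> X) (?\<Psi> X) 1 \<le> lieb_trace K X X 1"
        by simp
      then show "Re (trace (?\<Psi> K ** matrix_powr (?\<Psi> X) (- 1) ** cadjoint (?\<Psi> K)))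
          \<le> Re (trace (K ** matrix_powr X (- 1) ** cadjoint K))"
        by (simp add: lieb_trace_1 X pd less_eq_complex_def)
    qed
  next
    assume schwarz: "schwarz_map \<Phi>"
    show ?L
    proof (intro allI impI)
      fix t :: real and X Y K :: "complex^'m^'m"
      assume t: "0 \<le> t" "t \<le> 1" and X: "posdef X" and Y: "posdef Y"
      note dual = schwarz_map_imp_dual[OF assms schwarz]
      show "lieb_trace (?\<Psi> K) (?\<Psi> Y) (?\<Psi> X) t \<le> lieb_trace K Y X t"
      proof (rule lieb_trace_interpolation[OF hs_adjoint_linear X Y pd[OF X] pd[OF Y] _ _ t])
        show "matrix_linear \<Phi>" using assms(1) by (simp add: positive_map_def)
        fix K :: "complex^'m^'m"
        \<comment> \<open>The endpoint 0 is the endpoint 1 for the adjoint of \<open>K\<close> and with \<open>Y\<close> in the role of \<open>X\<close>.\<close>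
        show "Re (lieb_trace (?\<Psi> K) (?\<Psi> Y) (?\<Psi> X) 0) \<le> Re (lieb_trace K Y X 0)"
          using dual[OF Y, of "cadjoint K"]
          by (simp add: lieb_trace_0 X pd hs_adjoint_cadjoint[OF assms(1)])
        show "Re (lieb_trace (?\<Psi> K) (?\<Psi> Y) (?\<Psi> X) 1) \<le> Re (lieb_trace K Y X 1)"
          using dual[OF X, of K] by (simp add: lieb_trace_1 Y pd)
      qed
    qed
  qed
  then show ?thesis
    by (simp only: lieb_trace_def hs_adjoint_cadjoint[OF assms(1)])
qed

end
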